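(* Let $G\subset\mathcal{D}$ be a measurable set and let $M\in\mathbb{N}$, $M\ge1$, be fixed. For the numerical flows $\Phi_h^{[M]}$ and $\Psi_h^{[M]}$ of the $p$-implicit and the $q$-implicit Symplectic Euler methods with $M$ fixed point iterations for the Hamiltonian $H$, it holds that $$\lambda^{2N}(\Phi_h^{[M]}(G))=\lambda^{2N}(G)+\mathcal{O}(h^{M+1}),\quad h\to0,$$ $$\lambda^{2N}(\Psi_h^{[M]}(G))=\lambda^{2N}(G)+\mathcal{O}(h^{M+1}),\quad h\to0.$$ Moreover, let $M_1,M_2\in\mathbb{N}$, $M_1,M_2\ge1$, be fixed, and let $\Upsilon_h^{[M_1,M_2]}:=\Psi_{h/2}^{[M_2]}\circ\Phi_{h/2}^{[M_1]}$ and $\Lambda_h^{[M_1,M_2]}:=\Phi_{h/2}^{[M_2]}\circ\Psi_{h/2}^{[M_1]}$. Then $$\lambda^{2N}(\Upsilon_h^{[M_1,M_2]}(G))=\lambda^{2N}(G)+\mathcal{O}(h^{\min\{M_1,M_2\}+1}),\quad h\to0,$$ $$\lambda^{2N}(\Lambda_h^{[M_1,M_2]}(G))=\lambda^{2N}(G)+\mathcal{O}(h^{\min\{M_1,M_2\}+1}),\quad h\to0.$$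
   Context: $\lambda^{2N}$ is the Lebesgue measure on $\mathbb{R}^{2N}$. Let $N\ge 1$, let $\mathcal{D}\subset\mathbb{R}^N\times\mathbb{R}^N$ be compact and convex, and let $H=H(q,p)$ be a real-valued Hamiltonian which is sufficiently smooth on $\mathcal{D}$ (all derivatives exist and are continuous; concretely, $H$ is $C^\infty$ on an open neighbourhood of $\mathcal{D}$). $H_q,H_p$ denote the gradients of $H$ with respect to $q$ and $p$. For $M\ge 1$ and step $h>0$: - $\Phi_h^{[M]}$ ($p$-implicit Symplectic Euler with $M$ fixed point iterations): $p_0:=p$, $p_{n+1}:=p-hH_q(q,p_n)$ for $n=0,\dots,M-1$, $\tilde p:=p_M$, $\tilde q:=q+hH_p(q,\tilde p)$, $\Phi_h^{[M]}(q,p):=(\tilde q,\tilde p)$. - $\Psi_h^{[M]}$ ($q$-implicit Symplectic Euler with $M$ fixed point iterations): $q_0:=q$, $q_{n+1}:=q+hH_p(q_n,p)$ for $n=0,\dots,M-1$, $\tilde q:=q_M$, $\tilde p:=p-hH_q(\tilde q,p)$, $\Psi_h^{[M]}(q,p):=(\tilde q,\tilde p)$. Standing assumption: there is $h_0>0$ such that for all $0<h\le h_0$ and all initial values $(q,p)\in G$, all points at which $H$ and its derivatives are evaluated in the schemes concerned, and all intermediate and final results of the steps, lie in $\mathcal{D}$. $\mathcal{O}(h^r)$ denotes a quantity bounded in absolute value by $Ch^r$ for all sufficiently small $h>0$, with $C$ independent of $h$. *)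

theory Defs
  imports "HOL-Analysis.Analysis" "HOL-Library.Landau_Symbols"
begin

type_synonym 'n phase = "(real, 'n) vec \<times> (real, 'n) vec"

text \<open>
  Continuous differentiability of order \<open>k\<close> on a set that is meant to be open:
  \<open>f\<close> is Frechet differentiable at every point and all its directional derivatives are
  of order \<open>k - 1\<close>. Outside the domain of differentiability the value of
  \<^const>\<open>frechet_derivative\<close> is unspecified, but it is then never used.
\<close>

primrec continuously_differentiable_on ::
    "nat \<Rightarrow> ('a::real_normed_vector \<Rightarrow> 'b::real_normed_vector) \<Rightarrow> 'a set \<Rightarrow> bool" where
  "continuously_differentiable_on 0 f S \<longleftrightarrow> continuous_on S f"
| "continuously_differentiable_on (Suc k) f S \<longleftrightarrow>
     (\<forall>x\<in>S. f differentiable (at x)) \<and>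
     (\<forall>v. continuously_differentiable_on k (\<lambda>x. frechet_derivative f (at x) v) S)"

definition smooth_on :: "('a::real_normed_vector \<Rightarrow> 'b::real_normed_vector) \<Rightarrow> 'a set \<Rightarrow> bool" where
  "smooth_on f S \<longleftrightarrow> (\<forall>k. continuously_differentiable_on k f S)"

definition gradient :: "('a::real_inner \<Rightarrow> real) \<Rightarrow> 'a \<Rightarrow> 'a" where
  "gradient f x = (THE d. GDERIV f x :> d)"

lemma gradient_eqI:
  assumes "GDERIV f x :> d"
  shows "gradient f x = d"
  unfolding gradient_def
proof (rule the_equality[where P = "\<lambda>d. GDERIV f x :> d", OF assms])
  fix e assume "GDERIV f x :> e"
  then have "(\<lambda>h. inner h e) = (\<lambda>h. inner h d)"
    using assms has_derivative_unique unfolding gderiv_def by blast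
  then have "inner h e = inner h d" for h
    by (rule fun_cong)
  then show "e = d"
    using vector_eq_ldot by blast
qed

definition grad_q :: "('n::finite phase \<Rightarrow> real) \<Rightarrow> real ^ 'n \<Rightarrow> real ^ 'n \<Rightarrow> real ^ 'n" where
  "grad_q H q p = gradient (\<lambda>x. H (x, p)) q"

definition grad_p :: "('n::finite phase \<Rightarrow> real) \<Rightarrow> real ^ 'n \<Rightarrow> real ^ 'n \<Rightarrow> real ^ 'n" where
  "grad_p H q p = gradient (\<lambda>y. H (q, y)) p"

primrec p_iterate ::
    "('n::finite phase \<Rightarrow> real) \<Rightarrow> real \<Rightarrow> real ^ 'n \<Rightarrow> real ^ 'n \<Rightarrow> nat \<Rightarrow> real ^ 'n" where
  "p_iterate H h q p 0 = p"
| "p_iterate H h q p (Suc n) = p - h *\<^sub>R grad_q H q (p_iterate H h q p n)"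

definition p_implicit_euler ::
    "('n::finite phase \<Rightarrow> real) \<Rightarrow> nat \<Rightarrow> real \<Rightarrow> 'n phase \<Rightarrow> 'n phase" where
  "p_implicit_euler H M h = (\<lambda>(q, p).
     let p' = p_iterate H h q p M in (q + h *\<^sub>R grad_p H q p', p'))"

primrec q_iterate ::
    "('n::finite phase \<Rightarrow> real) \<Rightarrow> real \<Rightarrow> real ^ 'n \<Rightarrow> real ^ 'n \<Rightarrow> nat \<Rightarrow> real ^ 'n" where
  "q_iterate H h q p 0 = q"
| "q_iterate H h q p (Suc n) = q + h *\<^sub>R grad_p H (q_iterate H h q p n) p"

definition q_implicit_euler ::
    "('n::finite phase \<Rightarrow> real) \<Rightarrow> nat \<Rightarrow> real \<Rightarrow> 'n phase \<Rightarrow> 'n phase" where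
  "q_implicit_euler H M h = (\<lambda>(q, p).
     let q' = q_iterate H h q p M in (q', p - h *\<^sub>R grad_q H q' p))"

definition upsilon_flow ::
    "('n::finite phase \<Rightarrow> real) \<Rightarrow> nat \<Rightarrow> nat \<Rightarrow> real \<Rightarrow> 'n phase \<Rightarrow> 'n phase" where
  "upsilon_flow H M1 M2 h = q_implicit_euler H M2 (h / 2) \<circ> p_implicit_euler H M1 (h / 2)"

definition lambda_flow ::
    "('n::finite phase \<Rightarrow> real) \<Rightarrow> nat \<Rightarrow> nat \<Rightarrow> real \<Rightarrow> 'n phase \<Rightarrow> 'n phase" where
  "lambda_flow H M1 M2 h = p_implicit_euler H M2 (h / 2) \<circ> q_implicit_euler H M1 (h / 2)"

text \<open>
  A step stays in \<open>D\<close>: all intermediate points and the result lie in \<open>D\<close>. The derivatives of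
  \<open>H\<close> are evaluated exactly at the intermediate points with index \<open>n \<le> M\<close>; the one with
  \<open>n = M\<close> is where the explicit half of the step is evaluated.
\<close>

definition p_step_within ::
    "('n::finite phase \<Rightarrow> real) \<Rightarrow> 'n phase set \<Rightarrow> nat \<Rightarrow> real \<Rightarrow> 'n phase \<Rightarrow> bool" where
  "p_step_within H D M h z \<longleftrightarrow>
     (\<forall>n\<le>M. (fst z, p_iterate H h (fst z) (snd z) n) \<in> D) \<and> p_implicit_euler H M h z \<in> D"

definition q_step_within ::
    "('n::finite phase \<Rightarrow> real) \<Rightarrow> 'n phase set \<Rightarrow> nat \<Rightarrow> real \<Rightarrow> 'n phase \<Rightarrow> bool" where
  "q_step_within H D M h z \<longleftrightarrow>
     (\<forall>n\<le>M. (q_iterate H h (fst z) (snd z) n, snd z) \<in> D) \<and> q_implicit_euler H M h z \<in> D"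

definition upsilon_step_within ::
    "('n::finite phase \<Rightarrow> real) \<Rightarrow> 'n phase set \<Rightarrow> nat \<Rightarrow> nat \<Rightarrow> real \<Rightarrow> 'n phase \<Rightarrow> bool" where
  "upsilon_step_within H D M1 M2 h z \<longleftrightarrow>
     p_step_within H D M1 (h / 2) z \<and>
     q_step_within H D M2 (h / 2) (p_implicit_euler H M1 (h / 2) z)"

definition lambda_step_within ::
    "('n::finite phase \<Rightarrow> real) \<Rightarrow> 'n phase set \<Rightarrow> nat \<Rightarrow> nat \<Rightarrow> real \<Rightarrow> 'n phase \<Rightarrow> bool" where
  "lambda_step_within H D M1 M2 h z \<longleftrightarrow>
     q_step_within H D M1 (h / 2) z \<and>
     p_step_within H D M2 (h / 2) (q_implicit_euler H M1 (h / 2) z)"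

end

theory Submission
  imports Defs "HOL-Library.Numeral_Type"
begin

text \<open>
  Write the \<open>p\<close>-implicit step as \<open>\<Phi> = B \<circ> Z\<close>, where \<open>Z (q, p) = (q, p\<^sub>M)\<close> performs the
  fixed point iteration and \<open>B (q, p) = (q + h H\<^sub>p(q, p), p)\<close> is the explicit half. Let
  \<open>C (q, p) = (q, p + h H\<^sub>q(q, p))\<close> be the map that the exact implicit half would invert; the exact
  Symplectic Euler method is \<open>B \<circ> C\<inverse>\<close>. Since that method is symplectic, \<open>B'\<close> and \<open>C'\<close> pull the
  symplectic form back to the same bilinear form at every point (\<open>same_symplectic_form\<close>), so
  their Jacobian determinants agree in absolute value, and the chain rule gives
  \<open>\<bar>det \<Phi>'\<bar> = \<bar>det (C \<circ> Z)'\<bar>\<close>. By the change of variables formula \<open>\<Phi>\<close> and \<open>C \<circ> Z\<close> change volumes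
  by exactly the same amount.

  The map \<open>C \<circ> Z\<close> is close to the identity: \<open>C (Z z) = z + (Z z - Z\<^sup>+ z)\<close>, where \<open>Z\<^sup>+\<close> performs one
  iteration more, and consecutive iterates differ by \<open>O(h\<^sup>M\<^sup>+\<^sup>1)\<close> together with their derivatives
  (\<open>diter_increment\<close>). A linear map at distance \<open>\<epsilon>\<close> from the identity in dimension \<open>d\<close> has a
  determinant between \<open>(1 - \<epsilon>)\<^sup>d\<close> and \<open>(1 + \<epsilon>)\<^sup>d\<close>, because it maps the unit ball to a set between
  the balls of radii \<open>1 - \<epsilon>\<close> and \<open>1 + \<epsilon>\<close> (\<open>det_near_identity\<close>). Integration of the
  determinant gives the claim. The change of variables formula needs injective maps;
  \<open>Z\<close>, \<open>B\<close> and \<open>C\<close> are injective for small \<open>h\<close> because they are the identity plus a map with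
  Lipschitz constant of order \<open>h\<close>; convexity of \<open>D\<close> enters through these Lipschitz constants.

  The constants depend only on \<open>M\<close> and on bounds for the derivatives of \<open>H\<close> up to order three
  on \<open>D\<close>, not on the set that is transported. This uniformity is what allows the composition
  of two steps, where the second one acts on a set that depends on \<open>h\<close>
  (\<open>volume_preserving_to_order_compose\<close>).

  Both methods are treated at once as a splitting of \<open>J \<nabla>H\<close>, with \<open>J (q, p) = (p, -q)\<close>, into the
  part that is iterated and the part that is explicit; they differ only in the projection
  that selects the parts.
\<close>

section \<open>Volume of images under nearly volume-preserving maps\<close>

text \<open>
  The image of the unit ball lies between two concentric balls, and its volume is the
  absolute determinant times that of the unit ball.
\<close>

lemma det_near_identity:
  fixes f :: "real^'m::{finite,wellorder} \<Rightarrow> real^'m::_"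
  assumes f: "linear f" and near: "\<And>v. norm (f v - v) \<le> e * norm v" and e: "0 \<le> e" "e < 1"
  shows "(1 - e) ^ CARD('m) \<le> \<bar>det (matrix f)\<bar>" and "\<bar>det (matrix f)\<bar> \<le> (1 + e) ^ CARD('m)"
proof -
  let ?b = "ball (0::real^'m::{finite,wellorder}) 1"
  have m: "f ` ?b \<in> lmeasurable" "measure lebesgue (f ` ?b) = \<bar>det (matrix f)\<bar> * measure lebesgue ?b"
    using measurable_linear_image[OF f] measure_linear_image[OF f] by auto
  have pos: "measure lebesgue ?b > 0"
    by (simp add: content_ball_pos)
  have vol: "measure lebesgue (ball (0::real^'m::{finite,wellorder}) r) = r ^ CARD('m) * measure lebesgue ?b" if "r \<ge> 0" for r
    using content_ball_conv_unit_ball[OF that, of "0::real^'m::{finite,wellorder}"] by simp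
  have lower: "norm (f v) \<ge> (1 - e) * norm v" and upper: "norm (f v) \<le> (1 + e) * norm v" for v
  proof -
    have "norm v \<le> norm (f v) + norm (f v - v)"
      using norm_triangle_sub[of v "f v"] by (simp add: norm_minus_commute)
    then show "norm (f v) \<ge> (1 - e) * norm v"
      using near[of v] by (simp add: algebra_simps)
    have "norm (f v) \<le> norm v + norm (f v - v)"
      by (rule norm_triangle_sub)
    then show "norm (f v) \<le> (1 + e) * norm v"
      using near[of v] by (simp add: algebra_simps)
  qed
  have "inj f"
    unfolding linear_injective_0[OF f]
  proof (intro allI impI)
    fix v assume "f v = 0"
    with lower[of v] e show "v = 0"
      by (simp add: mult_le_0_iff)
  qed
  then have "surj f"
    using f linear_injective_imp_surjective by blast
  have "ball 0 (1 - e) \<subseteq> f ` ?b"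
  proof
    fix w :: "real^'m::{finite,wellorder}" assume w: "w \<in> ball 0 (1 - e)"
    obtain v where v: "w = f v"
      using \<open>surj f\<close> by blast
    with lower[of v] w have "(1 - e) * norm v < (1 - e) * 1"
      by simp
    then have "norm v < 1"
      using e by (simp only: mult_less_cancel_left_pos diff_gt_0_iff_gt)
    then show "w \<in> f ` ?b"
      using v by simp
  qed
  then have "measure lebesgue (ball (0::real^'m::{finite,wellorder}) (1 - e)) \<le> measure lebesgue (f ` ?b)"
    using m(1) by (intro measure_mono_fmeasurable) auto
  then show "(1 - e) ^ CARD('m) \<le> \<bar>det (matrix f)\<bar>"
    using vol[of "1 - e"] e pos m(2) by (simp add: mult_le_cancel_right)
  have "f ` ?b \<subseteq> ball 0 (1 + e)"
  proof safe
    fix v :: "real^'m::{finite,wellorder}" assume "v \<in> ?b"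
    then have "(1 + e) * norm v < (1 + e) * 1"
      using e by (intro mult_strict_left_mono) auto
    with upper[of v] show "f v \<in> ball 0 (1 + e)"
      by simp
  qed
  then have "measure lebesgue (f ` ?b) \<le> measure lebesgue (ball (0::real^'m::{finite,wellorder}) (1 + e))"
    using m(1) by (intro measure_mono_fmeasurable) (auto simp: fmeasurableD)
  then show "\<bar>det (matrix f)\<bar> \<le> (1 + e) ^ CARD('m)"
    using vol[of "1 + e"] e pos m(2) by (simp add: mult_le_cancel_right)
qed

text \<open>
  Pulling back the form \<open>u \<bullet> J v\<close> along \<open>f\<close> multiplies the determinant of its matrix by
  \<open>(det f)\<^sup>2\<close>. This yields equality of Jacobians without computing a block determinant.
\<close>

lemma abs_det_eq_if_same_bilinear_form:
  fixes f k J :: "real^'m \<Rightarrow> real^'m"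
  assumes f: "linear f" and k: "linear k" and J: "linear J" "inj J"
    and form: "\<And>u v. f u \<bullet> J (f v) = k u \<bullet> J (k v)"
  shows "\<bar>det (matrix f)\<bar> = \<bar>det (matrix k)\<bar>"
proof -
  have eq: "adjoint f \<circ> J \<circ> f = adjoint k \<circ> J \<circ> k"
  proof (rule ext)
    fix v
    have "u \<bullet> (adjoint f \<circ> J \<circ> f) v = u \<bullet> (adjoint k \<circ> J \<circ> k) v" for u
      using form[of u v] adjoint_works[OF f] adjoint_works[OF k] by simp
    then show "(adjoint f \<circ> J \<circ> f) v = (adjoint k \<circ> J \<circ> k) v"
      using vector_eq_ldot by blast
  qed
  have det: "det (matrix (adjoint g \<circ> J \<circ> g)) = (det (matrix g))\<^sup>2 * det (matrix J)" if g: "linear g" for g :: "real^'m \<Rightarrow> real^'m"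
  proof -
    have "matrix (adjoint g \<circ> J \<circ> g) = transpose (matrix g) ** matrix J ** matrix g"
      using g J adjoint_linear[OF g] by (simp add: matrix_compose linear_compose matrix_adjoint)
    then show ?thesis
      by (simp add: det_mul det_transpose power2_eq_square)
  qed
  have "det (matrix J) \<noteq> 0"
    using J det_nz_iff_inj by blast
  then have "(det (matrix f))\<^sup>2 = (det (matrix k))\<^sup>2"
    using det[OF f] det[OF k] eq by simp
  then show ?thesis
    using power2_eq_imp_eq[of "\<bar>det (matrix f)\<bar>" "\<bar>det (matrix k)\<bar>"] by simp
qed

lemma power_near_one_bounds:
  fixes e :: real
  assumes "0 \<le> e" "e \<le> 1"
  shows "1 - real d * 2 ^ d * e \<le> (1 - e) ^ d" and "(1 + e) ^ d \<le> 1 + real d * 2 ^ d * e"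
proof -
  have "real d * 1 * e \<le> real d * 2 ^ d * e"
    using assms by (intro mult_right_mono mult_left_mono) auto
  with Bernoulli_inequality[of "- e" d] assms show "1 - real d * 2 ^ d * e \<le> (1 - e) ^ d"
    by simp
  show "(1 + e) ^ d \<le> 1 + real d * 2 ^ d * e"
  proof (induction d)
    case (Suc d)
    have "(1 + e) ^ d \<le> 2 ^ d"
      using assms by (intro power_mono) auto
    then have "e * (1 + e) ^ d \<le> e * 2 ^ d"
      using assms by (intro mult_left_mono) auto
    moreover have "real d * 2 ^ d * e + e * 2 ^ d \<le> real (Suc d) * 2 ^ Suc d * e"
      using assms by (simp add: algebra_simps)
    ultimately show ?case
      using Suc by (simp add: algebra_simps)
  qed simp
qed

text \<open>
  The map \<open>k\<close>, which is close to the identity, only serves to control the determinant of \<open>f\<close>;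
  the map \<open>f\<close> itself may be further away from the identity.
\<close>

lemma measure_image_near_volume_preserving_vec:
  fixes f k :: "real^'m::{finite,wellorder} \<Rightarrow> real^'m::_" and e :: real
  assumes S: "S \<in> lmeasurable"
    and f: "\<And>x. x \<in> S \<Longrightarrow> (f has_derivative f' x) (at x within S)" "inj_on f S"
    and k: "\<And>x. x \<in> S \<Longrightarrow> (k has_derivative k' x) (at x within S)" "inj_on k S"
    and J: "linear J" "inj J"
    and form: "\<And>x u v. x \<in> S \<Longrightarrow> f' x u \<bullet> J (f' x v) = k' x u \<bullet> J (k' x v)"
    and near: "\<And>x v. x \<in> S \<Longrightarrow> norm (k' x v - v) \<le> e * norm v" and e: "0 \<le> e" "e < 1"
  shows "f ` S \<in> lmeasurable \<and>
    \<bar>measure lebesgue (f ` S) - measure lebesgue S\<bar>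
           \<le> real CARD('m) * 2 ^ CARD('m) * e * measure lebesgue S"
proof -
  let ?D = "\<lambda>x. \<bar>det (matrix (k' x))\<bar>" and ?c = "real CARD('m) * 2 ^ CARD('m) * e"
  have S': "S \<in> sets lebesgue"
    using S by (rule fmeasurableD)
  have lin: "linear (f' x)" "linear (k' x)" if "x \<in> S" for x
    using f(1)[OF that] k(1)[OF that] has_derivative_linear by blast+
  have detf: "\<bar>det (matrix (f' x))\<bar> = ?D x" if "x \<in> S" for x
    using that lin J form by (intro abs_det_eq_if_same_bilinear_form) auto
  have D: "1 - ?c \<le> ?D x" "?D x \<le> 1 + ?c" if "x \<in> S" for x
    using det_near_identity[OF lin(2)[OF that] near[OF that] e]
      power_near_one_bounds[of e "CARD('m)"] e by linarith+
  have int: "?D integrable_on S"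
  proof (rule measurable_bounded_by_integrable_imp_integrable[OF _ _ _ S'])
    show "?D \<in> borel_measurable (lebesgue_on S)"
      using borel_measurable_det_Jacobian[OF S' k(1)] by measurable
    show "(\<lambda>x. 1 + ?c) integrable_on S"
      by (rule integrable_on_const[OF S])
    show "norm (?D x) \<le> 1 + ?c" if "x \<in> S" for x
      using D(2)[OF that] by simp
  qed
  have "((\<lambda>x. \<bar>det (matrix (f' x))\<bar>) has_integral integral S ?D) S"
    using int detf by (intro has_integral_eq[OF _ integrable_integral[OF int]]) auto
  then have fS: "f ` S \<in> lmeasurable" "measure lebesgue (f ` S) = integral S ?D"
    using has_measure_differentiable_image[OF S' f] by auto
  have const: "integral S (\<lambda>x. c) = c * measure lebesgue S" for c :: real
    using integral_mult_right[of S c "\<lambda>x. 1"] lmeasure_integral[OF S] by simp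
  have "integral S (\<lambda>x. 1 - ?c) \<le> integral S ?D" "integral S ?D \<le> integral S (\<lambda>x. 1 + ?c)"
    using int D integrable_on_const[OF S] by (auto intro!: integral_le)
  then have "\<bar>measure lebesgue (f ` S) - measure lebesgue S\<bar> \<le> ?c * measure lebesgue S"
    unfolding const fS(2) by (simp add: algebra_simps abs_le_iff)
  with fS(1) show ?thesis
    by simp
qed

text \<open>
  The change of variables formula is about \<open>real^'m\<close> with a well-ordered index type. This
  lemma and the next two carry the estimate over to any Euclidean space of the same dimension,
  along a bijection between the standard bases; such a map preserves the volume of boxes, and
  boxes determine Lebesgue measure.
\<close>

lemma lebesgue_permute_basis:
  fixes T :: "'a::euclidean_space \<Rightarrow> 'b::euclidean_space"
  assumes T: "linear T" and \<beta>: "bij_betw \<beta> (Basis :: 'b set) (Basis :: 'a set)"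
    and T\<beta>: "\<And>x j. j \<in> Basis \<Longrightarrow> T x \<bullet> j = x \<bullet> \<beta> j"
    and S: "S \<in> lmeasurable"
  shows "T -` S \<in> lmeasurable" and "measure lebesgue (T -` S) = measure lebesgue S"
proof -
  have meas: "T \<in> borel_measurable borel"
    using T by (intro borel_measurable_continuous_onI linear_continuous_on linear_conv_bounded_linear[THEN iffD1])
  \<comment> \<open>\<open>R\<close> below is the inverse of \<open>T\<close>, so that the preimage of a box is the box with corners \<open>R l\<close>, \<open>R u\<close>\<close>
  have "lborel = distr lborel borel T"
  proof (rule lborel_eqI)
    fix l u :: 'b
    assume le: "\<And>b. b \<in> Basis \<Longrightarrow> l \<bullet> b \<le> u \<bullet> b"
    define R where "R = (\<lambda>y::'b. \<Sum>j\<in>Basis. (y \<bullet> j) *\<^sub>R \<beta> j)"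
    have R: "R y \<bullet> \<beta> j = y \<bullet> j" if "j \<in> Basis" for y j
    proof -
      have "R y \<bullet> \<beta> j = (\<Sum>i\<in>Basis. if i = j then y \<bullet> j else 0)"
        unfolding R_def inner_sum_left
      proof (rule sum.cong[OF refl])
        fix i :: 'b assume i: "i \<in> Basis"
        then have "\<beta> i \<bullet> \<beta> j = (if i = j then 1 else 0)"
          using that \<beta> by (metis bij_betwE bij_betw_imp_inj_on inj_onD inner_Basis)
        then show "(y \<bullet> i) *\<^sub>R \<beta> i \<bullet> \<beta> j = (if i = j then y \<bullet> j else 0)"
          by simp
      qed
      then show ?thesis using that by simp
    qed
    have all: "(\<forall>b\<in>Basis. P b) \<longleftrightarrow> (\<forall>j\<in>Basis. P (\<beta> j))" for P
      using \<beta> by (metis bij_betw_imp_surj_on ball_imageD imageE image_eqI)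
    have "T -` box l u = box (R l) (R u)"
      unfolding box_def all[where P = "\<lambda>b. R l \<bullet> b < _ \<bullet> b \<and> _ \<bullet> b < R u \<bullet> b"]
      using R T\<beta> by (auto simp: all[where P = "\<lambda>b. R l \<bullet> b < _ \<bullet> b \<and> _ \<bullet> b < R u \<bullet> b"])
    moreover have "\<forall>b\<in>Basis. R l \<bullet> b \<le> R u \<bullet> b"
      unfolding all[where P = "\<lambda>b. R l \<bullet> b \<le> R u \<bullet> b"] using R le by simp
    then have "emeasure lborel (box (R l) (R u)) = (\<Prod>b\<in>Basis. (R u - R l) \<bullet> b)"
      by (simp add: emeasure_lborel_box_eq)
    moreover have "(\<Prod>b\<in>Basis. (R u - R l) \<bullet> b) = (\<Prod>j\<in>Basis. (u - l) \<bullet> j)"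
      by (subst prod.reindex_bij_betw[OF \<beta>, symmetric]) (simp add: R inner_diff_left)
    ultimately show "emeasure (distr lborel borel T) (box l u) = (\<Prod>b\<in>Basis. (u - l) \<bullet> b)"
      using meas by (simp add: emeasure_distr)
  qed simp
  moreover have "distr lborel borel T = distr lborel lborel T"
    by (rule distr_cong) auto
  moreover have "distr lborel lborel T = distr (completion lborel) lborel T"
    using meas by (intro distr_completion[symmetric]) simp
  ultimately have d: "distr lebesgue lborel T = lborel"
    by simp
  have m: "T \<in> lebesgue \<rightarrow>\<^sub>M lborel"
    using meas by (simp add: measurable_completion)
  have eq: "lebesgue = distr lebesgue lebesgue T"
    using completion.completion_distr_eq[OF m] d by simp
  have m': "T \<in> lebesgue \<rightarrow>\<^sub>M lebesgue"
    using completion.measurable_completion2[OF m] d by simp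
  have em: "emeasure lebesgue (T -` S) = emeasure lebesgue S"
    using emeasure_distr[OF m', of S] fmeasurableD[OF S] eq by simp
  have "T -` S \<in> sets lebesgue"
    using measurable_sets[OF m' fmeasurableD[OF S]] by simp
  then show "T -` S \<in> lmeasurable"
    using em S by (auto simp: fmeasurable_def)
  show "measure lebesgue (T -` S) = measure lebesgue S"
    using em by (simp add: measure_def)
qed


lemma lebesgue_isometry_to_vec:
  assumes card: "CARD('m::finite) = DIM('a::euclidean_space)"
  obtains T :: "'a::euclidean_space \<Rightarrow> real^'m::finite" and T' :: "real^'m::finite \<Rightarrow> 'a::euclidean_space"
  where "linear T" "linear T'" "\<And>x. T' (T x) = x" "\<And>y. T (T' y) = y"
    "\<And>x y. T x \<bullet> T y = x \<bullet> y"
    "\<And>S. S \<in> lmeasurable \<Longrightarrow> T ` S \<in> lmeasurable \<and> measure lebesgue (T ` S) = measure lebesgue S"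
    "\<And>S. S \<in> lmeasurable \<Longrightarrow> T' ` S \<in> lmeasurable \<and> measure lebesgue (T' ` S) = measure lebesgue S"
proof -
  obtain b :: "'m \<Rightarrow> 'a" where b: "bij_betw b UNIV Basis"
    using card finite_same_card_bij[of "UNIV :: 'm set" "Basis :: 'a set"] by auto
  have bb: "b i \<bullet> b j = (if i = j then 1 else 0)" for i j
    using b by (metis UNIV_I bij_betwE bij_betw_imp_inj_on inj_eq inner_Basis)
  define T :: "'a \<Rightarrow> real^'m" where "T = (\<lambda>x. \<chi> i. x \<bullet> b i)"
  define T' :: "real^'m \<Rightarrow> 'a" where "T' = (\<lambda>y. \<Sum>i\<in>UNIV. (y $ i) *\<^sub>R b i)"
  have lin: "linear T" "linear T'"
    unfolding T_def T'_def
    by (auto intro!: linearI simp: vec_eq_iff inner_add_left scaleR_add_left sum.distrib scaleR_sum_right)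
  have T'b: "T' y \<bullet> b j = y $ j" for y j
    unfolding T'_def inner_sum_left by (simp add: bb if_distrib cong: if_cong)
  have TT': "T (T' y) = y" for y
    by (simp add: T_def T'b vec_eq_iff)
  have T'T: "T' (T x) = x" for x
    unfolding T_def T'_def
    using sum.reindex_bij_betw[OF b, of "\<lambda>c. (x \<bullet> c) *\<^sub>R c"] euclidean_representation[of x] by simp
  have inner: "T x \<bullet> T y = x \<bullet> y" for x y
    unfolding inner_vec_def T_def
    using sum.reindex_bij_betw[OF b, of "\<lambda>c. (x \<bullet> c) * (y \<bullet> c)"] euclidean_inner[of x y] by simp
  have axis: "bij_betw (\<lambda>i. axis i (1::real)) UNIV (Basis :: (real^'m) set)"
    by (auto simp: bij_betw_def inj_on_def axis_eq_axis Basis_vec_def)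
  define c :: "real^'m \<Rightarrow> 'm" where "c = inv_into UNIV (\<lambda>i. axis i 1)"
  have cb: "bij_betw c Basis UNIV"
    unfolding c_def by (rule bij_betw_inv_into[OF axis])
  have c: "c (axis i 1) = i" for i
    unfolding c_def using bij_betw_inv_into_left[OF axis, of i] by simp
  have pre: "T ` S = T' -` S" "T' ` U = T -` U" for S U
    by (auto simp: TT' T'T image_iff) (metis TT' T'T)+
  show thesis
  proof (rule that[OF lin T'T TT' inner])
    fix S :: "'a set" assume S: "S \<in> lmeasurable"
    have "bij_betw (\<lambda>e. axis (inv_into UNIV b e) (1::real)) Basis Basis"
      using bij_betw_trans[OF bij_betw_inv_into[OF b] axis] by (simp add: o_def)
    moreover have "T' y \<bullet> j = y \<bullet> axis (inv_into UNIV b j) 1" if "j \<in> Basis" for y j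
      using T'b[of y "inv_into UNIV b j"] bij_betw_inv_into_right[OF b that] by (simp add: inner_axis)
    ultimately show "T ` S \<in> lmeasurable \<and> measure lebesgue (T ` S) = measure lebesgue S"
      using lebesgue_permute_basis[OF lin(2) _ _ S] unfolding pre by blast
  next
    fix S :: "(real^'m) set" assume S: "S \<in> lmeasurable"
    have "bij_betw (\<lambda>e. b (c e)) Basis Basis"
      using bij_betw_trans[OF cb b] by (simp add: o_def)
    moreover have "T x \<bullet> j = x \<bullet> b (c j)" if "j \<in> Basis" for x j
      using that by (auto simp: Basis_vec_def T_def inner_axis c)
    ultimately show "T' ` S \<in> lmeasurable \<and> measure lebesgue (T' ` S) = measure lebesgue S"
      using lebesgue_permute_basis[OF lin(1) _ _ S] unfolding pre by blast
  qed
qed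

lemma measure_image_near_volume_preserving:
  fixes f k :: "'a::euclidean_space \<Rightarrow> 'a" and e :: real
  assumes card: "CARD('m::{finite,wellorder}) = DIM('a)"
    and S: "S \<in> lmeasurable"
    and f: "\<And>x. x \<in> S \<Longrightarrow> (f has_derivative f' x) (at x within S)" "inj_on f S"
    and k: "\<And>x. x \<in> S \<Longrightarrow> (k has_derivative k' x) (at x within S)" "inj_on k S"
    and J: "linear J" "inj J"
    and form: "\<And>x u v. x \<in> S \<Longrightarrow> f' x u \<bullet> J (f' x v) = k' x u \<bullet> J (k' x v)"
    and near: "\<And>x v. x \<in> S \<Longrightarrow> norm (k' x v - v) \<le> e * norm v" and e: "0 \<le> e" "e < 1"
  shows "f ` S \<in> lmeasurable"
    and "\<bar>measure lebesgue (f ` S) - measure lebesgue S\<bar>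
           \<le> real DIM('a) * 2 ^ DIM('a) * e * measure lebesgue S"
proof -
  obtain T :: "'a \<Rightarrow> real^'m::{finite,wellorder}" and T' :: "real^'m::{finite,wellorder} \<Rightarrow> 'a"
    where lin: "linear T" "linear T'" and inv: "\<And>x. T' (T x) = x" "\<And>y. T (T' y) = y"
      and inner: "\<And>x y. T x \<bullet> T y = x \<bullet> y"
      and T: "\<And>S. S \<in> lmeasurable \<Longrightarrow> T ` S \<in> lmeasurable \<and> measure lebesgue (T ` S) = measure lebesgue S"
      and T': "\<And>S. S \<in> lmeasurable \<Longrightarrow> T' ` S \<in> lmeasurable \<and> measure lebesgue (T' ` S) = measure lebesgue S"
    using lebesgue_isometry_to_vec[OF card] by blast
  have norm: "norm (T x) = norm x" for x
    by (simp add: norm_eq_sqrt_inner inner)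
  have img: "T' ` T ` U = U" for U
    by (auto simp: image_image inv)
  have bl: "bounded_linear T" "bounded_linear T'"
    using lin by (simp_all add: linear_conv_bounded_linear)
  have der: "((\<lambda>y. T (g (T' y))) has_derivative (\<lambda>w. T (g' (T' y) (T' w)))) (at y within T ` S)"
    if "\<And>x. x \<in> S \<Longrightarrow> (g has_derivative g' x) (at x within S)" "y \<in> T ` S" for g g' y
  proof -
    have "(g has_derivative g' (T' y)) (at (T' y) within T' ` T ` S)"
      using that unfolding img by (auto simp: inv)
    then have "((\<lambda>y. g (T' y)) has_derivative (\<lambda>w. g' (T' y) (T' w))) (at y within T ` S)"
      by (rule has_derivative_in_compose[OF bounded_linear_imp_has_derivative[OF bl(2)]])
    then show ?thesis
      by (rule bounded_linear.has_derivative[OF bl(1)])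
  qed
  have inj: "inj_on (\<lambda>y. T (g (T' y))) (T ` S)" if "inj_on g S" for g :: "'a \<Rightarrow> 'a"
    using that by (auto simp: inj_on_def inv) (metis inv(1))
  have TS: "T ` S \<in> lmeasurable" "measure lebesgue (T ` S) = measure lebesgue S"
    using T[OF S] by auto
  have J': "linear (\<lambda>y. T (J (T' y)))" "inj (\<lambda>y. T (J (T' y)))"
    using linear_compose[OF linear_compose[OF lin(2) J(1)] lin(1)] J(2) inv
    by (auto simp: o_def inj_def) metis
  have eq: "(\<lambda>y. T (f (T' y))) ` T ` S = T ` f ` S"
    by (auto simp: image_image inv)
  have *: "(\<lambda>y. T (f (T' y))) ` T ` S \<in> lmeasurable \<and>
    \<bar>measure lebesgue ((\<lambda>y. T (f (T' y))) ` T ` S) - measure lebesgue (T ` S)\<bar>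
      \<le> real CARD('m) * 2 ^ CARD('m) * e * measure lebesgue (T ` S)"
  proof (rule measure_image_near_volume_preserving_vec
        [OF TS(1) der[OF f(1)] inj[OF f(2)] der[OF k(1)] inj[OF k(2)] J' _ _ e])
    fix y u v assume "y \<in> T ` S"
    then have y: "T' y \<in> S"
      by (auto simp: inv)
    show "T (f' (T' y) (T' u)) \<bullet> T (J (T' (T (f' (T' y) (T' v))))) =
          T (k' (T' y) (T' u)) \<bullet> T (J (T' (T (k' (T' y) (T' v)))))"
      using form[OF y] by (simp add: inner inv)
    have "norm (T (k' (T' y) (T' v) - T' v)) \<le> e * norm (T (T' v))"
      unfolding norm by (rule near[OF y])
    then show "norm (T (k' (T' y) (T' v)) - v) \<le> e * norm v"
      by (simp add: linear_diff[OF lin(1)] inv)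
  qed
  have "T' ` T ` f ` S \<in> lmeasurable \<and> measure lebesgue (T' ` T ` f ` S) = measure lebesgue (T ` f ` S)"
    using T' * unfolding eq by blast
  then show "f ` S \<in> lmeasurable" "\<bar>measure lebesgue (f ` S) - measure lebesgue S\<bar>
           \<le> real DIM('a) * 2 ^ DIM('a) * e * measure lebesgue S"
    using * unfolding img eq TS(2) card by simp_all
qed

section \<open>Fixed point iteration for a field with Lipschitz derivative\<close>

primrec fixed_point_iterate :: "('a \<Rightarrow> 'a) \<Rightarrow> real \<Rightarrow> nat \<Rightarrow> 'a \<Rightarrow> 'a::real_vector" where
  "fixed_point_iterate f h 0 z = z"
| "fixed_point_iterate f h (Suc n) z = z + h *\<^sub>R f (fixed_point_iterate f h n z)"

text \<open>The formal derivative of the iterate with respect to the starting point \<open>z\<close>.\<close>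

primrec fixed_point_derivative ::
    "('a \<Rightarrow> 'a) \<Rightarrow> ('a \<Rightarrow> 'a \<Rightarrow> 'a) \<Rightarrow> real \<Rightarrow> nat \<Rightarrow> 'a \<Rightarrow> 'a \<Rightarrow> 'a::real_vector" where
  "fixed_point_derivative f f' h 0 z v = v"
| "fixed_point_derivative f f' h (Suc n) z v =
     v + h *\<^sub>R f' (fixed_point_iterate f h n z) (fixed_point_derivative f f' h n z v)"

lemma inj_on_perturbed_identity:
  fixes f :: "'a::real_normed_vector \<Rightarrow> 'a"
  assumes "\<And>x y. \<lbrakk>x \<in> S; y \<in> S\<rbrakk> \<Longrightarrow> norm ((f x - x) - (f y - y)) \<le> c * norm (x - y)" and "c < 1"
  shows "inj_on f S"
proof (rule inj_onI)
  fix x y assume "x \<in> S" "y \<in> S" "f x = f y"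
  then have "norm (y - x) \<le> c * norm (x - y)"
    using assms(1)[of x y] by simp
  then have "(1 - c) * norm (x - y) \<le> 0"
    by (simp add: algebra_simps norm_minus_commute)
  with \<open>c < 1\<close> show "x = y"
    by (simp add: mult_le_0_iff)
qed

text \<open>
  One constant \<open>L\<close> serves for the field, its derivative and both Lipschitz bounds. At
  boundary points of \<open>D\<close> the field is still differentiable in a full neighbourhood, so that the
  chain rule applies to the iterates at every starting point whose iterates lie in \<open>D\<close>, even
  if those of nearby starting points leave \<open>D\<close>.
\<close>

locale bounded_C2_field =
  fixes f :: "'a::euclidean_space \<Rightarrow> 'a" and f' :: "'a \<Rightarrow> 'a \<Rightarrow> 'a" and D :: "'a set" and L :: real
  assumes L_nonneg: "0 \<le> L"
    and deriv: "\<And>x. x \<in> D \<Longrightarrow> (f has_derivative f' x) (at x)"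
    and bound: "\<And>x. x \<in> D \<Longrightarrow> norm (f x) \<le> L"
    and deriv_bound: "\<And>x v. x \<in> D \<Longrightarrow> norm (f' x v) \<le> L * norm v"
    and lipschitz: "\<And>x y. \<lbrakk>x \<in> D; y \<in> D\<rbrakk> \<Longrightarrow> norm (f x - f y) \<le> L * norm (x - y)"
    and deriv_lipschitz: "\<And>x y v. \<lbrakk>x \<in> D; y \<in> D\<rbrakk> \<Longrightarrow> norm (f' x v - f' y v) \<le> L * norm (x - y) * norm v"
begin

abbreviation "iter \<equiv> fixed_point_iterate f"
abbreviation "diter \<equiv> fixed_point_derivative f f'"

lemma has_derivative_iter:
  assumes "\<forall>i<n. iter h i z \<in> D"
  shows "(iter h n has_derivative diter h n z) (at z)"
  using assms
proof (induction n)
  case 0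
  then show ?case by (simp add: has_derivative_ident)
next
  case (Suc n)
  have "((\<lambda>z. f (iter h n z)) has_derivative (\<lambda>v. f' (iter h n z) (diter h n z v))) (at z)"
    using Suc by (intro has_derivative_compose[OF Suc.IH deriv]) auto
  then have "((\<lambda>z. z + h *\<^sub>R f (iter h n z)) has_derivative
      (\<lambda>v. v + h *\<^sub>R f' (iter h n z) (diter h n z v))) (at z)"
    by (intro has_derivative_add has_derivative_ident has_derivative_scaleR_right)
  then show ?case
    by simp
qed

context
  fixes h :: real
  assumes h: "0 < h" "h * L \<le> 1 / 4"
begin

lemma iter_increment:
  assumes "\<forall>i\<le>n. iter h i z \<in> D"
  shows "norm (iter h (Suc n) z - iter h n z) \<le> (h * L) ^ Suc n"
  using assms
proof (induction n)
  case 0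
  then show ?case using bound h by simp
next
  case (Suc n)
  have "norm (iter h (Suc (Suc n)) z - iter h (Suc n) z) = h * norm (f (iter h (Suc n) z) - f (iter h n z))"
    using h by (simp flip: scaleR_diff_right)
  also have "\<dots> \<le> h * (L * norm (iter h (Suc n) z - iter h n z))"
    using h Suc.prems by (intro mult_left_mono lipschitz) (auto simp del: fixed_point_iterate.simps)
  also have "\<dots> \<le> h * (L * (h * L) ^ Suc n)"
    using h Suc L_nonneg by (intro mult_left_mono) (auto simp del: fixed_point_iterate.simps)
  finally show ?case by (simp add: mult_ac)
qed

lemma diter_bound:
  assumes "\<forall>i<n. iter h i z \<in> D"
  shows "norm (diter h n z v) \<le> 2 * norm v"
  using assms
proof (induction n)
  case (Suc n)
  have "norm (diter h (Suc n) z v) \<le> norm v + h * norm (f' (iter h n z) (diter h n z v))"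
    using h norm_triangle_ineq[of v "h *\<^sub>R f' (iter h n z) (diter h n z v)"] by simp
  also have "\<dots> \<le> norm v + h * (L * (2 * norm v))"
  proof -
    have "norm (f' (iter h n z) (diter h n z v)) \<le> L * norm (diter h n z v)"
      using Suc.prems by (intro deriv_bound) auto
    also have "\<dots> \<le> L * (2 * norm v)"
      using Suc L_nonneg by (intro mult_left_mono) auto
    finally show ?thesis using h by simp
  qed
  also have "\<dots> = norm v + 2 * (h * L * norm v)"
    by simp
  also have "\<dots> \<le> 2 * norm v"
    using mult_right_mono[OF h(2), of "norm v"] norm_ge_zero[of v] by linarith
  finally show ?case .
qed simp

text \<open>
  The difference of consecutive derivatives satisfies the recursion of \<open>iter_increment\<close> with
  an extra term from the change of the base point of \<open>f'\<close>. That term contributes \<open>2 (h L)\<^sup>n\<^sup>+\<^sup>2\<close> in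
  each step, whence the factor \<open>2 n + 1\<close>.
\<close>

lemma diter_increment:
  assumes "\<forall>i\<le>n. iter h i z \<in> D"
  shows "norm (diter h (Suc n) z v - diter h n z v) \<le> real (2 * n + 1) * (h * L) ^ Suc n * norm v"
  using assms
proof (induction n)
  case 0
  then show ?case using deriv_bound[of z v] h by (simp add: mult.assoc)
next
  case (Suc n)
  let ?x = "iter h (Suc n) z" and ?y = "iter h n z" and ?v = "diter h (Suc n) z v" and ?w = "diter h n z v"
  let ?r = "(h * L) ^ Suc n"
  have in_D: "?x \<in> D" "?y \<in> D"
    using Suc.prems by (auto simp del: fixed_point_iterate.simps)
  have lin: "linear (f' ?y)"
    using deriv[OF in_D(2)] by (rule has_derivative_linear)
  have r: "0 \<le> ?r"
    using h L_nonneg by simp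
  \<comment> \<open>split into a change of the base point and a change of the argument\<close>
  have "norm (f' ?x ?v - f' ?y ?w) \<le> norm (f' ?x ?v - f' ?y ?v) + norm (f' ?y (?v - ?w))"
    using norm_triangle_ineq[of "f' ?x ?v - f' ?y ?v" "f' ?y (?v - ?w)"] by (simp add: linear_diff[OF lin])
  also have "\<dots> \<le> L * norm (?x - ?y) * norm ?v + L * norm (?v - ?w)"
    by (intro add_mono deriv_lipschitz deriv_bound in_D)
  also have "\<dots> \<le> L * ?r * (2 * norm v) + L * (real (2 * n + 1) * ?r * norm v)"
    using Suc.prems Suc.IH L_nonneg iter_increment[of n z] diter_bound[of "Suc n" z v] r
    by (intro add_mono mult_mono) (auto simp del: fixed_point_iterate.simps fixed_point_derivative.simps)
  also have "\<dots> = real (2 * Suc n + 1) * (L * ?r) * norm v"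
    by (simp add: algebra_simps)
  finally have le: "norm (f' ?x ?v - f' ?y ?w) \<le> real (2 * Suc n + 1) * (L * ?r) * norm v" .
  have "norm (diter h (Suc (Suc n)) z v - ?v) = h * norm (f' ?x ?v - f' ?y ?w)"
    using h by (simp flip: scaleR_diff_right)
  also have "\<dots> \<le> h * (real (2 * Suc n + 1) * (L * ?r) * norm v)"
    using h by (intro mult_left_mono le) auto
  also have "\<dots> = real (2 * Suc n + 1) * (h * L) ^ Suc (Suc n) * norm v"
    by (simp add: mult_ac)
  finally show ?case .
qed

text \<open>
  Injectivity needs a bound on \<open>iter h n - id\<close> for pairs of starting points. It cannot be read
  off from the derivative, because the set of starting points whose iterates stay in
  \<open>D\<close> need not be convex; the Lipschitz bound on \<open>f\<close> is applied to the iterates instead.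
\<close>

lemma iter_perturbation_lipschitz:
  assumes "\<forall>i<n. iter h i z \<in> D" "\<forall>i<n. iter h i w \<in> D"
  shows "norm ((iter h n z - z) - (iter h n w - w)) \<le> 1 / 2 * norm (z - w)"
  using assms
proof (induction n)
  case (Suc n)
  let ?x = "iter h n z" and ?y = "iter h n w"
  have IH: "norm ((?x - z) - (?y - w)) \<le> 1 / 2 * norm (z - w)"
    using Suc by simp
  have "norm (?x - ?y) \<le> norm ((?x - z) - (?y - w)) + norm (z - w)"
    using norm_triangle_ineq[of "(?x - z) - (?y - w)" "z - w"] by simp
  with IH have xy: "norm (?x - ?y) \<le> 2 * norm (z - w)"
    using norm_ge_zero[of "z - w"] by linarith
  have "norm ((iter h (Suc n) z - z) - (iter h (Suc n) w - w)) = h * norm (f ?x - f ?y)"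
    using h by (simp flip: scaleR_diff_right)
  also have "\<dots> \<le> h * (L * norm (?x - ?y))"
    using h Suc.prems by (intro mult_left_mono lipschitz) auto
  also have "\<dots> \<le> h * L * (2 * norm (z - w))"
    using h L_nonneg xy by (simp add: mult.assoc mult_left_mono)
  also have "\<dots> \<le> 1 / 4 * (2 * norm (z - w))"
    using h by (intro mult_right_mono) auto
  finally show ?case
    by simp
qed simp

lemma inj_on_iter:
  assumes "\<And>z. z \<in> S \<Longrightarrow> \<forall>i<n. iter h i z \<in> D"
  shows "inj_on (iter h n) S"
proof (rule inj_on_perturbed_identity)
  fix x y assume "x \<in> S" "y \<in> S"
  then show "norm ((iter h n x - x) - (iter h n y - y)) \<le> 1 / 2 * norm (x - y)"
    using assms by (intro iter_perturbation_lipschitz)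
qed simp

text \<open>
  Both signs are of use: \<open>s = h\<close> is the explicit half of a step, \<open>s = - h\<close> is the map inverted
  by the exact solution of the implicit equation.
\<close>

lemma inj_on_explicit_step:
  assumes "\<bar>s\<bar> = h"
  shows "inj_on (\<lambda>x. x + s *\<^sub>R f x) D"
proof (rule inj_on_perturbed_identity)
  fix x y assume xy: "x \<in> D" "y \<in> D"
  have "norm ((x + s *\<^sub>R f x - x) - (y + s *\<^sub>R f y - y)) = h * norm (f x - f y)"
    using assms by (simp flip: scaleR_diff_right)
  also have "\<dots> \<le> h * (L * norm (x - y))"
    using h xy by (intro mult_left_mono lipschitz) auto
  also have "\<dots> \<le> 1 / 4 * norm (x - y)"
    using mult_right_mono[OF h(2), of "norm (x - y)"] by (simp add: mult.assoc)
  finally show "norm ((x + s *\<^sub>R f x - x) - (y + s *\<^sub>R f y - y)) \<le> 1 / 4 * norm (x - y)" .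
qed simp

end

end

section \<open>The gradient of a smooth function on a compact convex set\<close>

lemma second_difference_mean_value:
  fixes F :: "'a::real_normed_vector \<Rightarrow> real"
  assumes t: "0 < t"
    and inU: "\<And>a b. \<lbrakk>0 \<le> a; a \<le> t; 0 \<le> b; b \<le> t\<rbrakk> \<Longrightarrow> x + a *\<^sub>R u + b *\<^sub>R v \<in> U"
    and F: "\<And>y. y \<in> U \<Longrightarrow> (F has_derivative F1 y) (at y)"
    and F1: "\<And>y. y \<in> U \<Longrightarrow> ((\<lambda>y. F1 y u) has_derivative F2 y) (at y)"
  shows "\<exists>a b. 0 \<le> a \<and> a \<le> t \<and> 0 \<le> b \<and> b \<le> t \<and>
    F (x + t *\<^sub>R u + t *\<^sub>R v) - F (x + t *\<^sub>R u) - F (x + t *\<^sub>R v) + F x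
      = t * t * F2 (x + a *\<^sub>R u + b *\<^sub>R v) v"
proof -
  have along_u: "DERIV (\<lambda>s. F (x + s *\<^sub>R u + b *\<^sub>R v)) s :> F1 (x + s *\<^sub>R u + b *\<^sub>R v) u"
    if "0 \<le> s" "s \<le> t" "0 \<le> b" "b \<le> t" for s b
  proof -
    note y = inU[OF that]
    have "((\<lambda>s. x + s *\<^sub>R u + b *\<^sub>R v) has_derivative (\<lambda>r. r *\<^sub>R u)) (at s)"
      by (auto intro!: derivative_eq_intros)
    from has_derivative_compose[OF this F[OF y]]
    have "((\<lambda>s. F (x + s *\<^sub>R u + b *\<^sub>R v)) has_derivative (\<lambda>r. F1 (x + s *\<^sub>R u + b *\<^sub>R v) (r *\<^sub>R u))) (at s)" .
    then show ?thesis
      using linear_cmul[OF has_derivative_linear[OF F[OF y]]]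
      by (simp add: has_field_derivative_def mult.commute[of _ "F1 _ u"] fun_eq_iff)
  qed
  have along_v: "DERIV (\<lambda>s. F1 (x + a *\<^sub>R u + s *\<^sub>R v) u) s :> F2 (x + a *\<^sub>R u + s *\<^sub>R v) v"
    if "0 \<le> a" "a \<le> t" "0 \<le> s" "s \<le> t" for s a
  proof -
    note y = inU[OF that]
    have "((\<lambda>s. x + a *\<^sub>R u + s *\<^sub>R v) has_derivative (\<lambda>r. r *\<^sub>R v)) (at s)"
      by (auto intro!: derivative_eq_intros)
    from has_derivative_compose[OF this F1[OF y]]
    have "((\<lambda>s. F1 (x + a *\<^sub>R u + s *\<^sub>R v) u) has_derivative (\<lambda>r. F2 (x + a *\<^sub>R u + s *\<^sub>R v) (r *\<^sub>R v))) (at s)" .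
    then show ?thesis
      using linear_cmul[OF has_derivative_linear[OF F1[OF y]]]
      by (simp add: has_field_derivative_def mult.commute[of _ "F2 _ v"] fun_eq_iff)
  qed
  have "\<exists>a. 0 < a \<and> a < t \<and>
      (F (x + t *\<^sub>R u + t *\<^sub>R v) - F (x + t *\<^sub>R u + 0 *\<^sub>R v)) - (F (x + 0 *\<^sub>R u + t *\<^sub>R v) - F (x + 0 *\<^sub>R u + 0 *\<^sub>R v))
      = (t - 0) * (F1 (x + a *\<^sub>R u + t *\<^sub>R v) u - F1 (x + a *\<^sub>R u + 0 *\<^sub>R v) u)"
    using t by (intro MVT2 DERIV_diff along_u) auto
  then obtain a where a: "0 < a" "a < t" and
    1: "F (x + t *\<^sub>R u + t *\<^sub>R v) - F (x + t *\<^sub>R u) - F (x + t *\<^sub>R v) + F x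
      = t * (F1 (x + a *\<^sub>R u + t *\<^sub>R v) u - F1 (x + a *\<^sub>R u + 0 *\<^sub>R v) u)"
    by auto
  have "\<exists>b. 0 < b \<and> b < t \<and> F1 (x + a *\<^sub>R u + t *\<^sub>R v) u - F1 (x + a *\<^sub>R u + 0 *\<^sub>R v) u
      = (t - 0) * F2 (x + a *\<^sub>R u + b *\<^sub>R v) v"
    using t a by (intro MVT2 along_v) auto
  then obtain b where "0 < b" "b < t"
    "F1 (x + a *\<^sub>R u + t *\<^sub>R v) u - F1 (x + a *\<^sub>R u + 0 *\<^sub>R v) u = t * F2 (x + a *\<^sub>R u + b *\<^sub>R v) v"
    by auto
  with a 1 show ?thesis
    by (intro exI[of _ a] exI[of _ b]) auto
qed

text \<open>
  The second difference is symmetric in \<open>u\<close> and \<open>v\<close>, and by the mean value theorem it equals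
  \<open>t\<^sup>2\<close> times either mixed derivative at points that tend to \<open>x\<close> as \<open>t \<rightarrow> 0\<close>.
\<close>

lemma mixed_directional_derivatives_commute:
  fixes F :: "'a::real_normed_vector \<Rightarrow> real"
  assumes U: "open U" "x \<in> U"
    and F: "\<And>y. y \<in> U \<Longrightarrow> (F has_derivative F1 y) (at y)"
    and F1: "\<And>y w. y \<in> U \<Longrightarrow> ((\<lambda>y. F1 y w) has_derivative F2 w y) (at y)"
    and cont: "\<And>w w'. continuous_on U (\<lambda>y. F2 w y w')"
  shows "F2 u x v = F2 v x u"
proof (rule ccontr)
  assume ne: "F2 u x v \<noteq> F2 v x u"
  define e where "e = \<bar>F2 u x v - F2 v x u\<bar> / 2"
  have e: "e > 0"
    using ne by (simp add: e_def)
  have near: "\<forall>\<^sub>F y in nhds x. dist (F2 w y w') (F2 w x w') < e" for w w'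
  proof -
    have "((\<lambda>y. F2 w y w') \<longlongrightarrow> F2 w x w') (nhds x)"
      unfolding tendsto_at_iff_tendsto_nhds[of "\<lambda>y. F2 w y w'" x, symmetric]
      using cont[of w w'] U by (simp add: continuous_on_eq_continuous_at isCont_def)
    then show ?thesis
      using e by (rule tendstoD)
  qed
  obtain d where d: "d > 0" and
    dU: "\<And>y. dist y x < d \<Longrightarrow> y \<in> U" and
    duv: "\<And>y. dist y x < d \<Longrightarrow> dist (F2 u y v) (F2 u x v) < e" and
    dvu: "\<And>y. dist y x < d \<Longrightarrow> dist (F2 v y u) (F2 v x u) < e"
  proof -
    have "\<forall>\<^sub>F y in nhds x. y \<in> U \<and> dist (F2 u y v) (F2 u x v) < e \<and> dist (F2 v y u) (F2 v x u) < e"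
      using eventually_nhds_in_open[OF U] near[of u v] near[of v u] by (simp add: eventually_conj)
    then show thesis
      using that unfolding eventually_nhds_metric by blast
  qed
  define t where "t = d / (2 * (norm u + norm v + 1))"
  have t: "t > 0"
    using d by (simp add: t_def add_nonneg_pos)
  have "t * (norm u + norm v) < d"
  proof -
    have "t * (norm u + norm v) \<le> t * (norm u + norm v + 1)"
      using t by simp
    also have "\<dots> = d / 2"
      unfolding t_def by (simp add: field_simps add_nonneg_eq_0_iff add_pos_nonneg)
    finally show ?thesis using d by simp
  qed
  then have close: "dist (x + a *\<^sub>R u + b *\<^sub>R v) x < d" if "0 \<le> a" "a \<le> t" "0 \<le> b" "b \<le> t" for a b
  proof -
    have "dist (x + a *\<^sub>R u + b *\<^sub>R v) x = norm (a *\<^sub>R u + b *\<^sub>R v)"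
      by (simp add: dist_norm)
    also have "\<dots> \<le> norm (a *\<^sub>R u) + norm (b *\<^sub>R v)"
      by (rule norm_triangle_ineq)
    also have "\<dots> \<le> t * norm u + t * norm v"
      using that by (intro add_mono) (auto intro: mult_right_mono)
    finally show ?thesis
      using \<open>t * (norm u + norm v) < d\<close> by (simp add: distrib_left)
  qed
  obtain a b where ab: "0 \<le> a" "a \<le> t" "0 \<le> b" "b \<le> t"
    and 1: "F (x + t *\<^sub>R u + t *\<^sub>R v) - F (x + t *\<^sub>R u) - F (x + t *\<^sub>R v) + F x
      = t * t * F2 u (x + a *\<^sub>R u + b *\<^sub>R v) v"
    using second_difference_mean_value[OF t dU[OF close] F F1] by blast
  have close': "dist (x + a *\<^sub>R v + b *\<^sub>R u) x < d" if "0 \<le> a" "a \<le> t" "0 \<le> b" "b \<le> t" for a b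
    using close[OF that(3,4,1,2)] by (simp add: add_ac)
  obtain a' b' where ab': "0 \<le> a'" "a' \<le> t" "0 \<le> b'" "b' \<le> t"
    and 2: "F (x + t *\<^sub>R v + t *\<^sub>R u) - F (x + t *\<^sub>R v) - F (x + t *\<^sub>R u) + F x
      = t * t * F2 v (x + a' *\<^sub>R v + b' *\<^sub>R u) u"
    using second_difference_mean_value[OF t dU[OF close'] F F1] by blast
  have "t * t * F2 u (x + a *\<^sub>R u + b *\<^sub>R v) v = t * t * F2 v (x + a' *\<^sub>R v + b' *\<^sub>R u) u"
    using 1 2 by (simp only: add.assoc add.commute[of "t *\<^sub>R v" "t *\<^sub>R u"])
  then have "F2 u (x + a *\<^sub>R u + b *\<^sub>R v) v = F2 v (x + a' *\<^sub>R v + b' *\<^sub>R u) u"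
    using t by simp
  then have "\<bar>F2 u x v - F2 v x u\<bar> < 2 * e"
    using duv[OF close[OF ab]] dvu[OF close'[OF ab']] unfolding dist_real_def by linarith
  then show False
    by (simp add: e_def)
qed

lemma C1_Lipschitz_on_compact_convex:
  fixes f :: "'a::euclidean_space \<Rightarrow> 'b::real_normed_vector"
  assumes D: "compact D" "convex D"
    and f: "\<And>x. x \<in> D \<Longrightarrow> (f has_derivative f' x) (at x)"
    and cont: "\<And>b. b \<in> Basis \<Longrightarrow> continuous_on D (\<lambda>x. f' x b)"
  shows "\<exists>K\<ge>0. (\<forall>x\<in>D. \<forall>v. norm (f' x v) \<le> K * norm v) \<and>
    (\<forall>x\<in>D. \<forall>y\<in>D. norm (f x - f y) \<le> K * norm (x - y))"
proof -
  have "\<exists>k. \<forall>x\<in>D. norm (f' x b) \<le> k" if "b \<in> Basis" for b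
    using compact_imp_bounded[OF compact_continuous_image[OF cont[OF that] D(1)]]
    by (auto simp: bounded_iff)
  then obtain k where k: "\<And>b x. \<lbrakk>b \<in> Basis; x \<in> D\<rbrakk> \<Longrightarrow> norm (f' x b) \<le> k b"
    by metis
  define K where "K = (\<Sum>b\<in>Basis. \<bar>k b\<bar>)"
  have K: "norm (f' x v) \<le> K * norm v" if x: "x \<in> D" for x v
  proof -
    have lin: "linear (f' x)"
      using f[OF x] by (rule has_derivative_linear)
    have "f' x v = f' x (\<Sum>b\<in>Basis. (v \<bullet> b) *\<^sub>R b)"
      by (simp add: euclidean_representation)
    also have "\<dots> = (\<Sum>b\<in>Basis. (v \<bullet> b) *\<^sub>R f' x b)"
      by (simp add: linear_sum[OF lin] linear_cmul[OF lin])
    finally have "norm (f' x v) \<le> (\<Sum>b\<in>Basis. norm ((v \<bullet> b) *\<^sub>R f' x b))"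
      using norm_sum by metis
    also have "\<dots> \<le> (\<Sum>b\<in>Basis. \<bar>k b\<bar> * norm v)"
    proof (rule sum_mono)
      fix b :: 'a assume b: "b \<in> Basis"
      have "\<bar>v \<bullet> b\<bar> * norm (f' x b) \<le> norm v * \<bar>k b\<bar>"
        using Basis_le_norm[OF b] k[OF b x] by (intro mult_mono) auto
      then show "norm ((v \<bullet> b) *\<^sub>R f' x b) \<le> \<bar>k b\<bar> * norm v"
        by (simp add: mult.commute)
    qed
    finally show ?thesis
      by (simp add: K_def sum_distrib_right)
  qed
  have "norm (f x - f y) \<le> K * norm (x - y)" if "x \<in> D" "y \<in> D" for x y
  proof (rule differentiable_bound[OF D(2) _ _ that(1,2)])
    show "(f has_derivative f' z) (at z within D)" "onorm (f' z) \<le> K" if "z \<in> D" for z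
      using that f K by (auto intro: has_derivative_at_withinI onorm_le)
  qed
  moreover have "0 \<le> K"
    by (simp add: K_def sum_nonneg)
  ultimately show ?thesis
    using K by auto
qed

text \<open>
  The derivative of the gradient is the Hessian, which is self-adjoint by the symmetry of
  second derivatives; self-adjointness is what makes the exact method symplectic.
  Third derivatives provide the Lipschitz constant of the Hessian.
\<close>

lemma smooth_gradient_field:
  fixes H :: "'a::euclidean_space \<Rightarrow> real"
  assumes D: "compact D" "convex D" and U: "open U" "D \<subseteq> U" and H: "smooth_on H U"
  obtains g :: "'a \<Rightarrow> 'a" and g' :: "'a \<Rightarrow> 'a \<Rightarrow> 'a" and L :: real
  where "bounded_C2_field g g' D L"
    "\<forall>x\<in>D. GDERIV H x :> g x"
    "\<forall>x\<in>D. \<forall>u v. g' x u \<bullet> v = u \<bullet> g' x v"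
proof -
  define H1 where "H1 = (\<lambda>x. frechet_derivative H (at x))"
  define H2 where "H2 = (\<lambda>v x. frechet_derivative (\<lambda>x. H1 x v) (at x))"
  define H3 where "H3 = (\<lambda>v w x. frechet_derivative (\<lambda>x. H2 v x w) (at x))"
  have "continuously_differentiable_on (Suc (Suc (Suc 0))) H U"
    using H by (simp only: smooth_on_def)
  then have d: "\<And>x. x \<in> U \<Longrightarrow> H differentiable (at x)"
      "\<And>x v. x \<in> U \<Longrightarrow> (\<lambda>x. H1 x v) differentiable (at x)"
      "\<And>x v w. x \<in> U \<Longrightarrow> (\<lambda>x. H2 v x w) differentiable (at x)"
      and cont3: "\<And>u v w. continuous_on U (\<lambda>x. H3 v w x u)"
    by (simp_all add: H1_def H2_def H3_def)
  have H1: "(H has_derivative H1 x) (at x)" 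
    and H2: "((\<lambda>x. H1 x v) has_derivative H2 v x) (at x)"
    and H3: "((\<lambda>x. H2 v x w) has_derivative H3 v w x) (at x)" if "x \<in> U" for x v w
    using d[OF that] unfolding H1_def H2_def H3_def by (simp_all add: frechet_derivative_works)
  have cont2: "continuous_on U (\<lambda>x. H2 v x w)" for v w
    using H3 U(1) by (metis continuous_on_eq_continuous_at has_derivative_continuous)
  have sym: "H2 u x v = H2 v x u" if "x \<in> U" for x u v
    using mixed_directional_derivatives_commute[OF U(1) that H1 H2 cont2] .
  \<comment> \<open>gradient and Hessian, assembled from directional derivatives along the standard basis\<close>
  define g where "g = (\<lambda>x. \<Sum>b\<in>Basis. H1 x b *\<^sub>R b)"
  define g' where "g' = (\<lambda>x w. \<Sum>b\<in>Basis. H2 b x w *\<^sub>R b)"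
  have inner_g: "v \<bullet> g x = H1 x v" if "x \<in> U" for x v
  proof -
    have lin: "linear (H1 x)"
      using H1[OF that] by (rule has_derivative_linear)
    have "H1 x v = H1 x (\<Sum>b\<in>Basis. (v \<bullet> b) *\<^sub>R b)"
      by (simp add: euclidean_representation)
    also have "\<dots> = (\<Sum>b\<in>Basis. (v \<bullet> b) * H1 x b)"
      by (simp add: linear_sum[OF lin] linear_cmul[OF lin])
    finally show ?thesis
      by (simp add: g_def inner_sum_right mult.commute)
  qed
  have grad: "GDERIV H x :> g x" if "x \<in> U" for x
    unfolding gderiv_def using H1[OF that] inner_g[OF that] by (simp add: inner_commute)
  have g: "(g has_derivative g' x) (at x)" if "x \<in> U" for x
    unfolding g_def g'_def
    by (intro has_derivative_sum has_derivative_scaleR_left H2 that)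
  have inner_g': "v \<bullet> g' x w = H2 v x w" if "x \<in> U" for x v w
  proof -
    have "((\<lambda>x. v \<bullet> g x) has_derivative (\<lambda>w. v \<bullet> g' x w)) (at x)"
      by (intro has_derivative_inner_right g that)
    then have "((\<lambda>x. H1 x v) has_derivative (\<lambda>w. v \<bullet> g' x w)) (at x)"
      by (rule has_derivative_transform_within_open[OF _ U(1) that]) (simp add: inner_g)
    then show ?thesis
      using has_derivative_unique[OF _ H2[OF that]] by metis
  qed
  have selfadj: "g' x u \<bullet> v = u \<bullet> g' x v" if "x \<in> U" for x u v
    using inner_g'[OF that] sym[OF that] by (metis inner_commute)
  have contg': "continuous_on D (\<lambda>x. g' x w)" for w
    unfolding g'_def by (intro continuous_intros continuous_on_subset[OF cont2 U(2)])
  obtain K where K: "0 \<le> K" "\<And>x v. x \<in> D \<Longrightarrow> norm (g' x v) \<le> K * norm v"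
    "\<And>x y. \<lbrakk>x \<in> D; y \<in> D\<rbrakk> \<Longrightarrow> norm (g x - g y) \<le> K * norm (x - y)"
    using C1_Lipschitz_on_compact_convex[OF D g[OF subsetD[OF U(2)]] contg'] by blast
  have "continuous_on D g"
    using g U(2) by (meson continuous_at_imp_continuous_on has_derivative_continuous subsetD)
  then have "bounded (g ` D)"
    using D(1) compact_continuous_image compact_imp_bounded by blast
  then obtain B where B: "\<And>x. x \<in> D \<Longrightarrow> norm (g x) \<le> B"
    by (auto simp: bounded_iff)
  have "\<exists>k\<ge>0. \<forall>x\<in>D. \<forall>y\<in>D. \<bar>H2 b x c - H2 b y c\<bar> \<le> k * norm (x - y)" for b c
    using C1_Lipschitz_on_compact_convex[OF D H3[OF subsetD[OF U(2)]] continuous_on_subset[OF cont3 U(2)], of b c]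
    by auto
  then obtain k where k: "\<And>b c. k b c \<ge> 0"
    "\<And>b c x y. \<lbrakk>x \<in> D; y \<in> D\<rbrakk> \<Longrightarrow> \<bar>H2 b x c - H2 b y c\<bar> \<le> k b c * norm (x - y)"
    by metis
  define M where "M = (\<Sum>b\<in>Basis. \<Sum>c\<in>Basis. k b c)"
  have M: "norm (g' x v - g' y v) \<le> M * norm (x - y) * norm v" if xy: "x \<in> D" "y \<in> D" for x y v
  proof -
    have exp: "H2 b z v = (\<Sum>c\<in>Basis. (v \<bullet> c) * H2 b z c)" if "z \<in> D" for z b
    proof -
      have lin: "linear (H2 b z)"
        using H2 that U(2) has_derivative_linear by blast
      have "H2 b z v = H2 b z (\<Sum>c\<in>Basis. (v \<bullet> c) *\<^sub>R c)"
        by (simp add: euclidean_representation)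
      then show ?thesis
        by (simp add: linear_sum[OF lin] linear_cmul[OF lin])
    qed
    have "\<bar>H2 b x v - H2 b y v\<bar> \<le> (\<Sum>c\<in>Basis. k b c) * norm (x - y) * norm v" for b
    proof -
      have "\<bar>H2 b x v - H2 b y v\<bar> = \<bar>\<Sum>c\<in>Basis. (v \<bullet> c) * (H2 b x c - H2 b y c)\<bar>"
        by (simp add: exp xy sum_subtractf right_diff_distrib)
      also have "\<dots> \<le> (\<Sum>c\<in>Basis. \<bar>v \<bullet> c\<bar> * \<bar>H2 b x c - H2 b y c\<bar>)"
        using sum_abs[of "\<lambda>c. (v \<bullet> c) * (H2 b x c - H2 b y c)" Basis] by (simp add: abs_mult)
      also have "\<dots> \<le> (\<Sum>c\<in>Basis. norm v * (k b c * norm (x - y)))"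
        by (intro sum_mono mult_mono k(2) xy) (auto simp: Basis_le_norm)
      finally show ?thesis
        by (simp add: sum_distrib_left sum_distrib_right mult_ac)
    qed
    then have "(\<Sum>b\<in>Basis. \<bar>H2 b x v - H2 b y v\<bar>) \<le> (\<Sum>b\<in>Basis. (\<Sum>c\<in>Basis. k b c) * norm (x - y) * norm v)"
      by (intro sum_mono)
    moreover have "norm (g' x v - g' y v) \<le> (\<Sum>b\<in>Basis. \<bar>H2 b x v - H2 b y v\<bar>)"
    proof -
      have "g' x v - g' y v = (\<Sum>b\<in>Basis. (H2 b x v - H2 b y v) *\<^sub>R b)"
        by (simp add: g'_def sum_subtractf scaleR_left_diff_distrib)
      also have "norm \<dots> \<le> (\<Sum>b\<in>Basis. norm ((H2 b x v - H2 b y v) *\<^sub>R b))"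
        by (rule norm_sum)
      finally show ?thesis
        by simp
    qed
    ultimately show ?thesis
      by (simp add: M_def sum_distrib_right)
  qed
  have "0 \<le> M"
    using k(1) by (simp add: M_def sum_nonneg)
  define L where "L = K + M + \<bar>B\<bar>"
  have le: "K \<le> L" "M \<le> L" "B \<le> L" "0 \<le> L"
    using K(1) \<open>0 \<le> M\<close> by (auto simp: L_def)
  have "bounded_C2_field g g' D L"
  proof
    show "0 \<le> L" by (rule le(4))
    fix x y v assume x: "x \<in> D"
    then show "(g has_derivative g' x) (at x)"
      using g U(2) by blast
    show "norm (g x) \<le> L"
      using B[OF x] le(3) by simp
    show "norm (g' x v) \<le> L * norm v"
      using K(2)[OF x, of v] mult_right_mono[OF le(1), of "norm v"] by simp
    assume y: "y \<in> D"
    show "norm (g x - g y) \<le> L * norm (x - y)"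
      using K(3)[OF x y] mult_right_mono[OF le(1), of "norm (x - y)"] by simp
    show "norm (g' x v - g' y v) \<le> L * norm (x - y) * norm v"
      using M[OF x y, of v] mult_right_mono[OF le(2), of "norm (x - y) * norm v"]
      by (simp add: mult.assoc)
  qed
  then show thesis
    using that grad selfadj U(2) by blast
qed

section \<open>Symplectic splitting and the volume estimate for one step\<close>

lemma norm_orthogonal_projection_le:
  fixes P :: "'a::real_inner \<Rightarrow> 'a"
  assumes "\<And>x y. P x \<bullet> y = x \<bullet> P y" "\<And>x. P (P x) = P x"
  shows "norm (P x) \<le> norm x"
proof (cases "P x = 0")
  case False
  have "norm (P x) * norm (P x) = x \<bullet> P x"
    using assms by (simp flip: power2_eq_square add: power2_norm_eq_inner)
  also have "\<dots> \<le> norm x * norm (P x)"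
    by (rule norm_cauchy_schwarz)
  finally show ?thesis
    using False by simp
qed simp

text \<open>
  \<open>J\<close> is a compatible complex structure, so that \<open>x \<bullet> J y\<close> is the symplectic form, and \<open>\<pi>\<close> is the
  orthogonal projection onto a Lagrangian subspace that \<open>J\<close> maps to its orthogonal
  complement; this is what \<open>proj_J\<close> says. For a phase space, \<open>\<pi>\<close> projects to the
  positions or to the momenta.
\<close>

locale symplectic_splitting = bounded_C2_field g g' D L
  for g :: "'a::euclidean_space \<Rightarrow> 'a" and g' :: "'a \<Rightarrow> 'a \<Rightarrow> 'a" and D :: "'a set" and L :: real +
  fixes J \<pi> :: "'a \<Rightarrow> 'a"
  assumes linear_J: "linear J" and J_skew: "\<And>x y. J x \<bullet> y = - (x \<bullet> J y)" and J_J: "\<And>x. J (J x) = - x"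
    and linear_proj: "linear \<pi>" and proj_selfadjoint: "\<And>x y. \<pi> x \<bullet> y = x \<bullet> \<pi> y"
    and proj_proj: "\<And>x. \<pi> (\<pi> x) = \<pi> x" and proj_J: "\<And>x. \<pi> (J x) = J (x - \<pi> x)"
    and deriv_selfadjoint: "\<And>x u v. x \<in> D \<Longrightarrow> g' x u \<bullet> v = u \<bullet> g' x v"
begin

lemma norm_J: "norm (J x) = norm x"
  by (simp add: norm_eq_sqrt_inner J_skew J_J)

lemma contraction_of_bounded_C2_field:
  assumes P: "linear P" "\<And>x. norm (P x) \<le> norm x"
  shows "bounded_C2_field (\<lambda>x. P (g x)) (\<lambda>x v. P (g' x v)) D L"
proof
  have bl: "bounded_linear P"
    using P(1) by (simp add: linear_conv_bounded_linear)
  show "0 \<le> L" by (rule L_nonneg)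
  show "((\<lambda>x. P (g x)) has_derivative (\<lambda>v. P (g' x v))) (at x)" if "x \<in> D" for x
    by (rule bounded_linear.has_derivative[OF bl deriv[OF that]])
  show "norm (P (g x)) \<le> L" if "x \<in> D" for x
    using P(2) bound[OF that] by (rule order_trans)
  show "norm (P (g' x v)) \<le> L * norm v" if "x \<in> D" for x v
    using P(2) deriv_bound[OF that] by (rule order_trans)
  show "norm (P (g x) - P (g y)) \<le> L * norm (x - y)" if "x \<in> D" "y \<in> D" for x y
    unfolding linear_diff[OF P(1), symmetric] using P(2) lipschitz[OF that] by (rule order_trans)
  show "norm (P (g' x v) - P (g' y v)) \<le> L * norm (x - y) * norm v" if "x \<in> D" "y \<in> D" for x y v
    unfolding linear_diff[OF P(1), symmetric] using P(2) deriv_lipschitz[OF that] by (rule order_trans)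
qed

definition implicit_part :: "'a \<Rightarrow> 'a" where
  "implicit_part x = \<pi> (J x)"

definition explicit_part :: "'a \<Rightarrow> 'a" where
  "explicit_part x = J x - \<pi> (J x)"

sublocale imp: bounded_C2_field "\<lambda>x. implicit_part (g x)" "\<lambda>x v. implicit_part (g' x v)" D L
proof (rule contraction_of_bounded_C2_field)
  show "linear implicit_part"
    unfolding implicit_part_def using linear_compose[OF linear_J linear_proj] by (simp add: o_def)
  show "norm (implicit_part x) \<le> norm x" for x
    using norm_orthogonal_projection_le[of \<pi> "J x"] proj_selfadjoint proj_proj
    by (simp add: implicit_part_def norm_J)
qed

sublocale exp: bounded_C2_field "\<lambda>x. explicit_part (g x)" "\<lambda>x v. explicit_part (g' x v)" D L
proof (rule contraction_of_bounded_C2_field)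
  show "linear explicit_part"
    unfolding explicit_part_def
    using linear_compose_sub[OF linear_J linear_compose[OF linear_J linear_proj]] by (simp add: o_def)
  have "norm (J x - \<pi> (J x)) \<le> norm (J x)" for x
    by (rule norm_orthogonal_projection_le[of "\<lambda>y. y - \<pi> y"])
      (simp_all add: inner_diff_left inner_diff_right proj_selfadjoint linear_diff[OF linear_proj] proj_proj)
  then show "norm (explicit_part x) \<le> norm x" for x
    by (simp add: explicit_part_def norm_J)
qed

definition euler_step :: "nat \<Rightarrow> real \<Rightarrow> 'a \<Rightarrow> 'a" where
  "euler_step M h z = (let x = imp.iter h M z in x + h *\<^sub>R explicit_part (g x))"

text \<open>
  With \<open>S\<close> the Hessian, the two sides are the pullbacks of the symplectic form along the
  derivatives \<open>B'\<close> and \<open>C'\<close> of the explicit half and of the map inverted by the exact implicit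
  half. Both are equal to \<open>u \<bullet> J v - h (u \<bullet> \<pi> (S v)) + h (S u \<bullet> \<pi> v)\<close>: the terms of order \<open>h\<^sup>2\<close>
  vanish because the corrections lie in Lagrangian subspaces. Equality of the pullbacks is
  the symplecticity of the exact method in a form that does not require inverting \<open>C'\<close>.
\<close>

lemma same_symplectic_form:
  assumes S: "\<And>u v. S u \<bullet> v = u \<bullet> S v"
  shows "(u + h *\<^sub>R explicit_part (S u)) \<bullet> J (v + h *\<^sub>R explicit_part (S v))
       = (u - h *\<^sub>R implicit_part (S u)) \<bullet> J (v - h *\<^sub>R implicit_part (S v))"
proof -
  have JP: "J (\<pi> x) = J x - \<pi> (J x)" for x
    using proj_J[of x] linear_diff[OF linear_J] by simp
  have lin: "J (x + y) = J x + J y" "J (x - y) = J x - J y" "J (c *\<^sub>R x) = c *\<^sub>R J x" "J (- x) = - J x"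
      "\<pi> (x + y) = \<pi> x + \<pi> y" "\<pi> (x - y) = \<pi> x - \<pi> y" "\<pi> (- x) = - \<pi> x" for x y c
    using linear_J linear_proj by (simp_all add: linear_add linear_diff linear_cmul linear_neg)
  have Jexp: "J (explicit_part y) = - \<pi> y" and Jimp: "J (implicit_part y) = \<pi> y - y" for y
    by (simp_all add: explicit_part_def implicit_part_def lin JP J_J)
  have 1: "explicit_part x \<bullet> J y = x \<bullet> \<pi> y" and 2: "implicit_part x \<bullet> J y = x \<bullet> y - x \<bullet> \<pi> y" for x y
  proof -
    have "explicit_part x \<bullet> J y = - (J (explicit_part x) \<bullet> y)"
      by (simp add: J_skew)
    then show "explicit_part x \<bullet> J y = x \<bullet> \<pi> y"
      by (simp add: Jexp proj_selfadjoint)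
    have "implicit_part x \<bullet> J y = - (J (implicit_part x) \<bullet> y)"
      by (simp add: J_skew)
    then show "implicit_part x \<bullet> J y = x \<bullet> y - x \<bullet> \<pi> y"
      by (simp add: Jimp proj_selfadjoint inner_diff_left)
  qed
  have 3: "explicit_part x \<bullet> \<pi> y = 0" "implicit_part x \<bullet> (\<pi> y - y) = 0" for x y
  proof -
    have "\<pi> (explicit_part x) = 0"
      by (simp add: explicit_part_def lin(6) proj_proj)
    then show "explicit_part x \<bullet> \<pi> y = 0"
      by (simp flip: proj_selfadjoint)
    have "implicit_part x \<bullet> (\<pi> y - y) = J x \<bullet> \<pi> (\<pi> y - y)"
      by (simp only: implicit_part_def proj_selfadjoint)
    then show "implicit_part x \<bullet> (\<pi> y - y) = 0"
      by (simp add: lin(6) proj_proj)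
  qed
  have "(u + h *\<^sub>R explicit_part (S u)) \<bullet> J (v + h *\<^sub>R explicit_part (S v))
      = u \<bullet> J v - h * (u \<bullet> \<pi> (S v)) + h * (S u \<bullet> \<pi> v)"
    by (simp add: lin Jexp inner_add_left inner_add_right inner_diff_right 1 3)
  moreover have "(u - h *\<^sub>R implicit_part (S u)) \<bullet> J (v - h *\<^sub>R implicit_part (S v))
      = u \<bullet> J v - h * (u \<bullet> (\<pi> (S v) - S v)) - h * (S u \<bullet> v - S u \<bullet> \<pi> v)"
    by (simp add: lin Jimp inner_diff_left inner_diff_right[of _ "J v"] 2 3)
  ultimately show ?thesis
    by (simp add: inner_diff_right S algebra_simps)
qed

text \<open>
  The bound on \<open>h\<close> achieves two things: \<open>h L \<le> 1 / 4\<close>, which makes all maps injective, and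
  \<open>(2 M + 1) (h L)\<^sup>M\<^sup>+\<^sup>1 < 1\<close>, which keeps the derivative of the comparison map invertible.
\<close>

lemma euler_step_volume_estimate:
  assumes card: "CARD('m::{finite,wellorder}) = DIM('a)"
    and h: "0 < h" "h \<le> 1 / (real (2 * M + 4) * (L + 1))"
    and S: "S \<in> lmeasurable" and in_D: "\<And>z. z \<in> S \<Longrightarrow> \<forall>n\<le>M. imp.iter h n z \<in> D"
  shows "euler_step M h ` S \<in> lmeasurable"
    and "\<bar>measure lebesgue (euler_step M h ` S) - measure lebesgue S\<bar>
      \<le> real DIM('a) * 2 ^ DIM('a) * (real (2 * M + 1) * (h * L) ^ (M + 1)) * measure lebesgue S"
proof -
  have "h * L \<le> h * (L + 1)"
    using h by simp
  also have "\<dots> \<le> 1 / real (2 * M + 4)"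
    using mult_right_mono[OF h(2), of "L + 1"] L_nonneg by simp
  finally have hL: "h * L \<le> 1 / real (2 * M + 4)" .
  also have "\<dots> \<le> 1 / 4"
    by (simp add: field_simps)
  finally have hL4: "h * L \<le> 1 / 4" .
  have hL0: "0 \<le> h * L"
    using h L_nonneg by simp
  let ?e = "real (2 * M + 1) * (h * L) ^ (M + 1)"
  have e: "0 \<le> ?e" "?e < 1"
  proof -
    show "0 \<le> ?e"
      using hL0 by simp
    have "?e = real (2 * M + 1) * (h * L) * (h * L) ^ M"
      by simp
    also have "\<dots> \<le> real (2 * M + 1) * (h * L) * 1"
      using hL0 hL4 by (intro mult_left_mono power_le_one) auto
    also have "\<dots> = real (2 * M + 1) * (h * L)"
      by simp
    also have "\<dots> \<le> real (2 * M + 1) * (1 / real (2 * M + 4))"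
      by (intro mult_left_mono hL) simp
    also have "\<dots> < 1"
      by (simp add: field_simps)
    finally show "?e < 1" .
  qed
  let ?Z = "imp.iter h M" and ?Z' = "imp.diter h M"
  let ?C = "\<lambda>x. x + (- h) *\<^sub>R implicit_part (g x)" and ?B = "\<lambda>x. x + h *\<^sub>R explicit_part (g x)"
  \<comment> \<open>\<open>f'\<close> is the derivative of the step \<open>?B \<circ> ?Z\<close>, and \<open>k'\<close> that of the comparison map \<open>?C \<circ> ?Z\<close>\<close>
  define f' where "f' = (\<lambda>z v. ?Z' z v + h *\<^sub>R explicit_part (g' (?Z z) (?Z' z v)))"
  define k' where "k' = (\<lambda>z v. ?Z' z v + (- h) *\<^sub>R implicit_part (g' (?Z z) (?Z' z v)))"
  have Z: "(?Z has_derivative ?Z' z) (at z)" if "z \<in> S" for z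
    using in_D[OF that] by (intro imp.has_derivative_iter) auto
  have ZD: "?Z z \<in> D" if "z \<in> S" for z
    using in_D[OF that] by blast
  have injZ: "inj_on ?Z S"
    using in_D by (intro imp.inj_on_iter[OF h(1) hL4]) auto
  have inj: "inj_on (\<lambda>z. F (?Z z)) S" if "inj_on F D" for F :: "'a \<Rightarrow> 'a"
    using comp_inj_on[OF injZ inj_on_subset[OF that]] ZD by (auto simp: o_def)
  have eq: "euler_step M h = (\<lambda>z. ?B (?Z z))"
    by (simp add: euler_step_def Let_def fun_eq_iff)
  have f: "(euler_step M h has_derivative f' z) (at z within S)"
    and k: "((\<lambda>z. ?C (?Z z)) has_derivative k' z) (at z within S)" if "z \<in> S" for z
  proof -
    have "(?B has_derivative (\<lambda>v. v + h *\<^sub>R explicit_part (g' (?Z z) v))) (at (?Z z))"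
      by (intro has_derivative_add has_derivative_ident has_derivative_scaleR_right exp.deriv ZD that)
    from has_derivative_compose[OF Z[OF that] this]
    show "(euler_step M h has_derivative f' z) (at z within S)"
      unfolding eq f'_def by (rule has_derivative_at_withinI)
    have "(?C has_derivative (\<lambda>v. v + (- h) *\<^sub>R implicit_part (g' (?Z z) v))) (at (?Z z))"
      by (intro has_derivative_add has_derivative_ident has_derivative_scaleR_right imp.deriv ZD that)
    from has_derivative_compose[OF Z[OF that] this]
    show "((\<lambda>z. ?C (?Z z)) has_derivative k' z) (at z within S)"
      unfolding k'_def by (rule has_derivative_at_withinI)
  qed
  have inj_f: "inj_on (euler_step M h) S"
    unfolding eq using h(1) by (intro inj exp.inj_on_explicit_step[OF h(1) hL4]) simp
  have inj_k: "inj_on (\<lambda>z. ?C (?Z z)) S"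
    using h(1) by (intro inj[where F = ?C] imp.inj_on_explicit_step[OF h(1) hL4]) simp
  have inj_J: "inj J"
    by (rule injI) (metis J_J neg_equal_iff_equal)
  have form: "f' z u \<bullet> J (f' z v) = k' z u \<bullet> J (k' z v)" if "z \<in> S" for z u v
    using same_symplectic_form[OF deriv_selfadjoint[OF ZD[OF that]], of "?Z' z u" h "?Z' z v"]
    by (simp add: f'_def k'_def)
  have near: "norm (k' z v - v) \<le> ?e * norm v" if "z \<in> S" for z v
  proof -
    \<comment> \<open>\<open>?C (?Z z) - z\<close> is minus the difference of the iterates number \<open>M + 1\<close> and \<open>M\<close>\<close>
    have "k' z v - v = - (imp.diter h (Suc M) z v - ?Z' z v)"
      by (simp add: k'_def)
    then show ?thesis
      using imp.diter_increment[OF h(1) hL4 in_D[OF that], of v] by (simp only: norm_minus_cancel Suc_eq_plus1)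
  qed
  show "euler_step M h ` S \<in> lmeasurable"
    by (rule measure_image_near_volume_preserving(1)
        [OF card S f inj_f k inj_k linear_J inj_J form near e])
  show "\<bar>measure lebesgue (euler_step M h ` S) - measure lebesgue S\<bar>
      \<le> real DIM('a) * 2 ^ DIM('a) * ?e * measure lebesgue S"
    by (rule measure_image_near_volume_preserving(2)
        [OF card S f inj_f k inj_k linear_J inj_J form near e])
qed

end

section \<open>Order of volume preservation, and the Symplectic Euler methods\<close>

text \<open>
  \<open>P h z\<close> states that the step of size \<open>h\<close> from \<open>z\<close> is admissible. The constants \<open>h1\<close> and
  \<open>C\<close> must not depend on \<open>S\<close>, so that a second step can be applied to the image of the first.
\<close>

definition volume_preserving_to_order ::
    "nat \<Rightarrow> (real \<Rightarrow> 'a::euclidean_space \<Rightarrow> 'a) \<Rightarrow> (real \<Rightarrow> 'a \<Rightarrow> bool) \<Rightarrow> bool" where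
  "volume_preserving_to_order r \<phi> P \<longleftrightarrow>
     (\<exists>h1>0. \<exists>C\<ge>0. \<forall>h S. 0 < h \<and> h \<le> h1 \<and> S \<in> lmeasurable \<and> (\<forall>z\<in>S. P h z) \<longrightarrow>
        \<phi> h ` S \<in> lmeasurable \<and>
        \<bar>measure lebesgue (\<phi> h ` S) - measure lebesgue S\<bar> \<le> C * h ^ r * measure lebesgue S)"

lemma volume_preserving_to_orderD:
  assumes \<phi>: "volume_preserving_to_order r \<phi> P" and G: "G \<in> lmeasurable"
    and P: "\<exists>h0>0. \<forall>h. 0 < h \<and> h \<le> h0 \<longrightarrow> (\<forall>z\<in>G. P h z)"
  shows "(\<forall>\<^sub>F h in at_right 0. \<phi> h ` G \<in> lmeasurable) \<and>
    (\<lambda>h. measure lebesgue (\<phi> h ` G) - measure lebesgue G) \<in> O[at_right 0](\<lambda>h. h ^ r)"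
proof -
  obtain h0 where h0: "0 < h0" "\<And>h z. \<lbrakk>0 < h; h \<le> h0; z \<in> G\<rbrakk> \<Longrightarrow> P h z"
    using P by blast
  obtain h1 C where h1: "0 < h1" "0 \<le> C"
    and est: "\<forall>h S. 0 < h \<and> h \<le> h1 \<and> S \<in> lmeasurable \<and> (\<forall>z\<in>S. P h z) \<longrightarrow> \<phi> h ` S \<in> lmeasurable \<and>
      \<bar>measure lebesgue (\<phi> h ` S) - measure lebesgue S\<bar> \<le> C * h ^ r * measure lebesgue S"
    using \<phi> unfolding volume_preserving_to_order_def by (elim exE conjE)
  note est = est[rule_format, OF conjI[OF _ conjI[OF _ conjI[OF G]]]]
  have "\<forall>\<^sub>F h in at_right 0. h \<in> {0<..<min h0 h1}"
    using h0(1) h1(1) by (intro eventually_at_right_real) simp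
  then have "\<forall>\<^sub>F h in at_right 0. \<phi> h ` G \<in> lmeasurable \<and>
    norm (measure lebesgue (\<phi> h ` G) - measure lebesgue G) \<le> C * measure lebesgue G * norm (h ^ r)"
  proof eventually_elim
    case (elim h)
    then have "\<phi> h ` G \<in> lmeasurable \<and>
        \<bar>measure lebesgue (\<phi> h ` G) - measure lebesgue G\<bar> \<le> C * h ^ r * measure lebesgue G"
      using h0(2) by (intro est) auto
    then show ?case
      using elim by (simp add: mult.commute mult.left_commute)
  qed
  then show ?thesis
    by (intro conjI bigoI[where c = "C * measure lebesgue G"]) (auto elim: eventually_mono)
qed

lemma volume_preserving_to_order_compose:
  assumes \<phi>: "volume_preserving_to_order r \<phi> P" and \<psi>: "volume_preserving_to_order s \<psi> Q"
  shows "volume_preserving_to_order (min r s) (\<lambda>h. \<psi> (h / 2) \<circ> \<phi> (h / 2))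
    (\<lambda>h z. P (h / 2) z \<and> Q (h / 2) (\<phi> (h / 2) z))"
proof -
  let ?m = "measure lebesgue"
  obtain h1 C where h1: "0 < h1" "0 \<le> C"
    and est1: "\<forall>h S. 0 < h \<and> h \<le> h1 \<and> S \<in> lmeasurable \<and> (\<forall>z\<in>S. P h z) \<longrightarrow>
      \<phi> h ` S \<in> lmeasurable \<and> \<bar>?m (\<phi> h ` S) - ?m S\<bar> \<le> C * h ^ r * ?m S"
    using \<phi> unfolding volume_preserving_to_order_def by (elim exE conjE)
  obtain h2 K where h2: "0 < h2" "0 \<le> K"
    and est2: "\<forall>h S. 0 < h \<and> h \<le> h2 \<and> S \<in> lmeasurable \<and> (\<forall>z\<in>S. Q h z) \<longrightarrow>
      \<psi> h ` S \<in> lmeasurable \<and> \<bar>?m (\<psi> h ` S) - ?m S\<bar> \<le> K * h ^ s * ?m S"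
    using \<psi> unfolding volume_preserving_to_order_def by (elim exE conjE)
  define h3 where "h3 = min 1 (min h1 h2)"
  have pos: "0 < h3" "0 \<le> K * (1 + C) + C"
    using h1 h2 by (auto simp: h3_def)
  show ?thesis
    unfolding volume_preserving_to_order_def
  proof (rule exI[of _ h3], rule conjI[OF pos(1)], rule exI[of _ "K * (1 + C) + C"],
      rule conjI[OF pos(2)], intro allI impI conjI)
    fix h S
    assume "0 < h \<and> h \<le> h3 \<and> S \<in> lmeasurable \<and> (\<forall>z\<in>S. P (h / 2) z \<and> Q (h / 2) (\<phi> (h / 2) z))"
    then have h: "0 < h / 2" "h / 2 \<le> h1" "h / 2 \<le> h2" "h / 2 \<le> 1" "0 < h" "h \<le> 1" and S: "S \<in> lmeasurable"
      and PQ: "\<forall>z\<in>S. P (h / 2) z" "\<forall>z\<in>\<phi> (h / 2) ` S. Q (h / 2) z"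
      by (auto simp: h3_def)
    let ?T = "\<phi> (h / 2) ` S" and ?d = "h ^ min r s"
    have pow: "(h / 2) ^ n \<le> ?d" if "min r s \<le> n" for n
    proof -
      have "(h / 2) ^ n \<le> h ^ n"
        using h by (intro power_mono) auto
      also have "\<dots> \<le> ?d"
        using h that by (intro power_decreasing) auto
      finally show ?thesis .
    qed
    have T: "?T \<in> lmeasurable" "\<bar>?m ?T - ?m S\<bar> \<le> C * (h / 2) ^ r * ?m S"
      using est1[rule_format, of "h / 2" S] h(1,2) S PQ(1) by simp_all
    have T': "\<psi> (h / 2) ` ?T \<in> lmeasurable" "\<bar>?m (\<psi> (h / 2) ` ?T) - ?m ?T\<bar> \<le> K * (h / 2) ^ s * ?m ?T"
      using est2[rule_format, of "h / 2" ?T] h(1,3) T(1) PQ(2) by simp_all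
    show "(\<psi> (h / 2) \<circ> \<phi> (h / 2)) ` S \<in> lmeasurable"
      using T'(1) by (simp only: image_comp)
    have 1: "\<bar>?m ?T - ?m S\<bar> \<le> C * ?d * ?m S"
      using T(2) by (rule order_trans) (intro mult_right_mono mult_left_mono pow h1; simp)
    have "?d \<le> 1"
      using h by (intro power_le_one) auto
    then have "C * ?d * ?m S \<le> C * 1 * ?m S"
      using h1 by (intro mult_right_mono mult_left_mono) auto
    \<comment> \<open>The second step acts on a set of volume at most \<open>1 + C\<close> times that of \<open>S\<close>.\<close>
    with 1 have "?m ?T \<le> (1 + C) * ?m S"
      by (simp add: distrib_right)
    then have "K * (h / 2) ^ s * ?m ?T \<le> K * ?d * ((1 + C) * ?m S)"
      using h h1 h2 by (intro mult_mono mult_left_mono pow) auto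
    with T'(2) 1 have "\<bar>?m (\<psi> (h / 2) ` ?T) - ?m S\<bar> \<le> K * ?d * ((1 + C) * ?m S) + C * ?d * ?m S"
      by linarith
    also have "\<dots> = (K * (1 + C) + C) * ?d * ?m S"
      by (simp add: algebra_simps)
    finally show "\<bar>?m ((\<psi> (h / 2) \<circ> \<phi> (h / 2)) ` S) - ?m S\<bar> \<le> (K * (1 + C) + C) * ?d * ?m S"
      by (simp only: image_comp)
  qed
qed

text \<open>
  The method \<open>\<phi>\<close> has to agree with the abstract step at admissible points only, since
  the abstract field \<open>g\<close> is known to be the gradient of \<open>H\<close> only on \<open>D\<close>.
\<close>

lemma (in symplectic_splitting) euler_step_volume_preserving_to_order:
  assumes card: "CARD('m::{finite,wellorder}) = DIM('a)"
    and \<phi>: "\<And>h z. P h z \<Longrightarrow> (\<forall>n\<le>M. imp.iter h n z \<in> D) \<and> \<phi> h z = euler_step M h z"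
  shows "volume_preserving_to_order (M + 1) \<phi> P"
  unfolding volume_preserving_to_order_def
proof (intro exI conjI allI impI)
  let ?h1 = "1 / (real (2 * M + 4) * (L + 1))"
  let ?C = "real DIM('a) * 2 ^ DIM('a) * (real (2 * M + 1) * L ^ (M + 1))"
  show "0 < ?h1" "0 \<le> ?C"
    using L_nonneg by (simp_all add: add_nonneg_pos)
  fix h :: real and S :: "'a set"
  assume *: "0 < h \<and> h \<le> ?h1 \<and> S \<in> lmeasurable \<and> (\<forall>z\<in>S. P h z)"
  then have "\<phi> h ` S = euler_step M h ` S"
    using \<phi> by (intro image_cong) auto
  moreover have "\<forall>n\<le>M. imp.iter h n z \<in> D" if "z \<in> S" for z
    using * \<phi> that by blast
  ultimately show "\<phi> h ` S \<in> lmeasurable"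
    "\<bar>measure lebesgue (\<phi> h ` S) - measure lebesgue S\<bar> \<le> ?C * h ^ (M + 1) * measure lebesgue S"
    using euler_step_volume_estimate[OF card, of h M S] * by (simp_all add: power_mult_distrib mult_ac)
qed

lemma gradient_components:
  assumes "GDERIV H (q, p) :> d"
  shows "grad_q H q p = fst d" and "grad_p H q p = snd d"
proof -
  have H: "(H has_derivative (\<lambda>v. v \<bullet> d)) (at (q, p))"
    using assms by (simp add: gderiv_def)
  have "((\<lambda>x. (x, p)) has_derivative (\<lambda>v. (v, 0))) (at q)"
    by (intro has_derivative_Pair has_derivative_ident has_derivative_const)
  from has_derivative_compose[OF this H]
  have "GDERIV (\<lambda>x. H (x, p)) q :> fst d"
    by (simp add: gderiv_def inner_prod_def)
  then show "grad_q H q p = fst d"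
    unfolding grad_q_def by (rule gradient_eqI)
  have "((\<lambda>y. (q, y)) has_derivative (\<lambda>v. (0, v))) (at p)"
    by (intro has_derivative_Pair has_derivative_ident has_derivative_const)
  from has_derivative_compose[OF this H]
  have "GDERIV (\<lambda>y. H (q, y)) p :> snd d"
    by (simp add: gderiv_def inner_prod_def)
  then show "grad_p H q p = snd d"
    unfolding grad_p_def by (rule gradient_eqI)
qed

text \<open>
  With \<open>J (q, p) = (p, - q)\<close>, the component of \<open>J \<nabla>H = (H\<^sub>p, - H\<^sub>q)\<close> that is iterated is the
  momentum component for the \<open>p\<close>-implicit method and the position component for the
  \<open>q\<close>-implicit one.
\<close>

lemma symplectic_euler_volume_preserving_to_order:
  fixes H :: "'n::finite phase \<Rightarrow> real"
  assumes D: "compact D" "convex D" and U: "open U" "D \<subseteq> U" and H: "smooth_on H U"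
  shows "volume_preserving_to_order (M + 1) (p_implicit_euler H M) (p_step_within H D M)"
    and "volume_preserving_to_order (M + 1) (q_implicit_euler H M) (q_step_within H D M)"
proof -
  obtain g g' L where g: "bounded_C2_field g g' D L"
    and grad: "\<forall>x\<in>D. GDERIV H x :> g x" and selfadj: "\<forall>x\<in>D. \<forall>u v. g' x u \<bullet> v = u \<bullet> g' x v"
    using smooth_gradient_field[OF D U H] .
  interpret bounded_C2_field g g' D L by (rule g)
  have grad_q: "grad_q H q p = fst (g (q, p))" and grad_p: "grad_p H q p = snd (g (q, p))"
    if "(q, p) \<in> D" for q p
    using gradient_components[OF bspec[OF grad that]] by auto
  let ?J = "\<lambda>z::'n phase. (snd z, - fst z)"
  have J: "linear ?J" "\<And>x y. ?J x \<bullet> y = - (x \<bullet> ?J y)" "\<And>x. ?J (?J x) = - x"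
    by (auto intro!: linearI simp: inner_prod_def prod_eq_iff inner_commute)
  \<comment> \<open>\<open>'n bit0\<close> is a well-ordered type with twice as many elements as \<open>'n\<close>\<close>
  have card: "CARD('n bit0) = DIM('n phase)"
    by simp
  interpret p: symplectic_splitting g g' D L ?J "\<lambda>z. (0, snd z)"
    by unfold_locales (use J selfadj in \<open>auto intro!: linearI simp: inner_prod_def\<close>)
  interpret q: symplectic_splitting g g' D L ?J "\<lambda>z. (fst z, 0)"
    by unfold_locales (use J selfadj in \<open>auto intro!: linearI simp: inner_prod_def\<close>)
  show "volume_preserving_to_order (M + 1) (p_implicit_euler H M) (p_step_within H D M)"
  proof (rule p.euler_step_volume_preserving_to_order[OF card])
    fix h z assume z: "p_step_within H D M h z"
    obtain q0 p0 where z_def: "z = (q0, p0)"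
      by (cases z)
    have in_D: "(q0, p_iterate H h q0 p0 n) \<in> D" if "n \<le> M" for n
      using z that by (simp add: p_step_within_def z_def)
    have iter: "p.imp.iter h n z = (q0, p_iterate H h q0 p0 n)" if "n \<le> M" for n
      using that
    proof (induction n)
      case (Suc n)
      then show ?case
        using grad_q[OF in_D[of n]] by (simp add: p.implicit_part_def z_def)
    qed (simp add: z_def)
    show "(\<forall>n\<le>M. p.imp.iter h n z \<in> D) \<and> p_implicit_euler H M h z = p.euler_step M h z"
      using iter in_D grad_p[OF in_D[of M]]
      by (simp add: p_implicit_euler_def p.euler_step_def p.explicit_part_def z_def Let_def)
  qed
  show "volume_preserving_to_order (M + 1) (q_implicit_euler H M) (q_step_within H D M)"
  proof (rule q.euler_step_volume_preserving_to_order[OF card])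
    fix h z assume z: "q_step_within H D M h z"
    obtain q0 p0 where z_def: "z = (q0, p0)"
      by (cases z)
    have in_D: "(q_iterate H h q0 p0 n, p0) \<in> D" if "n \<le> M" for n
      using z that by (simp add: q_step_within_def z_def)
    have iter: "q.imp.iter h n z = (q_iterate H h q0 p0 n, p0)" if "n \<le> M" for n
      using that
    proof (induction n)
      case (Suc n)
      then show ?case
        using grad_p[OF in_D[of n]] by (simp add: q.implicit_part_def z_def)
    qed (simp add: z_def)
    show "(\<forall>n\<le>M. q.imp.iter h n z \<in> D) \<and> q_implicit_euler H M h z = q.euler_step M h z"
      using iter in_D grad_q[OF in_D[of M]]
      by (simp add: q_implicit_euler_def q.euler_step_def q.explicit_part_def z_def Let_def)
  qed
qed

theorem theorem8:
  fixes H :: "'n::finite phase \<Rightarrow> real" and D G U :: "'n phase set"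
  assumes "compact D" and "convex D"
    and "open U" and "D \<subseteq> U" and "smooth_on H U"
    and "G \<subseteq> D" and "G \<in> sets lebesgue"
  shows
    "(\<forall>M. M \<ge> 1 \<longrightarrow>
         (\<exists>h0>0. \<forall>h. 0 < h \<and> h \<le> h0 \<longrightarrow> (\<forall>z\<in>G. p_step_within H D M h z)) \<longrightarrow>
         (\<forall>\<^sub>F h in at_right 0. p_implicit_euler H M h ` G \<in> lmeasurable) \<and>
         (\<lambda>h. measure lebesgue (p_implicit_euler H M h ` G) - measure lebesgue G)
           \<in> O[at_right 0](\<lambda>h. h ^ (M + 1))) \<and>
     (\<forall>M. M \<ge> 1 \<longrightarrow>
         (\<exists>h0>0. \<forall>h. 0 < h \<and> h \<le> h0 \<longrightarrow> (\<forall>z\<in>G. q_step_within H D M h z)) \<longrightarrow>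
         (\<forall>\<^sub>F h in at_right 0. q_implicit_euler H M h ` G \<in> lmeasurable) \<and>
         (\<lambda>h. measure lebesgue (q_implicit_euler H M h ` G) - measure lebesgue G)
           \<in> O[at_right 0](\<lambda>h. h ^ (M + 1))) \<and>
     (\<forall>M1 M2. M1 \<ge> 1 \<and> M2 \<ge> 1 \<longrightarrow>
         (\<exists>h0>0. \<forall>h. 0 < h \<and> h \<le> h0 \<longrightarrow> (\<forall>z\<in>G. upsilon_step_within H D M1 M2 h z)) \<longrightarrow>
         (\<forall>\<^sub>F h in at_right 0. upsilon_flow H M1 M2 h ` G \<in> lmeasurable) \<and>
         (\<lambda>h. measure lebesgue (upsilon_flow H M1 M2 h ` G) - measure lebesgue G)
           \<in> O[at_right 0](\<lambda>h. h ^ (min M1 M2 + 1))) \<and>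
     (\<forall>M1 M2. M1 \<ge> 1 \<and> M2 \<ge> 1 \<longrightarrow>
         (\<exists>h0>0. \<forall>h. 0 < h \<and> h \<le> h0 \<longrightarrow> (\<forall>z\<in>G. lambda_step_within H D M1 M2 h z)) \<longrightarrow>
         (\<forall>\<^sub>F h in at_right 0. lambda_flow H M1 M2 h ` G \<in> lmeasurable) \<and>
         (\<lambda>h. measure lebesgue (lambda_flow H M1 M2 h ` G) - measure lebesgue G)
           \<in> O[at_right 0](\<lambda>h. h ^ (min M1 M2 + 1)))"
proof -
  note \<phi> = symplectic_euler_volume_preserving_to_order[OF assms(1-5)]
  have G: "G \<in> lmeasurable"
    using assms(1,6,7) bounded_set_imp_lmeasurable bounded_subset compact_imp_bounded by blast
  have upsilon: "volume_preserving_to_order (min M1 M2 + 1) (upsilon_flow H M1 M2) (upsilon_step_within H D M1 M2)"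
    for M1 M2
    using volume_preserving_to_order_compose[OF \<phi>(1)[of M1] \<phi>(2)[of M2]]
    by (simp add: upsilon_flow_def[abs_def] upsilon_step_within_def[abs_def])
  have lambda: "volume_preserving_to_order (min M1 M2 + 1) (lambda_flow H M1 M2) (lambda_step_within H D M1 M2)"
    for M1 M2
    using volume_preserving_to_order_compose[OF \<phi>(2)[of M1] \<phi>(1)[of M2]]
    by (simp add: lambda_flow_def[abs_def] lambda_step_within_def[abs_def])
  show ?thesis
    by (rule conjI, (intro allI impI, erule volume_preserving_to_orderD[OF \<phi>(1) G]),
        rule conjI, (intro allI impI, erule volume_preserving_to_orderD[OF \<phi>(2) G]),
        rule conjI, (intro allI impI, erule volume_preserving_to_orderD[OF upsilon G]),
        intro allI impI, erule volume_preserving_to_orderD[OF lambda G])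
qed

end
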